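(* Let $X$ be a nonseparable real Banach space satisfying at least one of the following: (1) $X$ admits a fundamental biorthogonal system; (2) $X$ is of the form $C(K)$ for some scattered compact Hausdorff space $K$; (3) $X$ contains an isomorphic copy of $\ell_1(\omega_1)$; (4) the dual ball $B_{X^*}$ of $X^*$ has uncountable tightness in the weak$^*$ topology. Then $X$ can be covered by $\omega_1$ hyperplanes, i.e., $\mathfrak{cov}(X)=\omega_1$.
   Context: A hyperplane of a Banach space $X$ is a one-codimensional closed linear subspace of $X$. $\mathcal{H}_\sigma(X)$ is the family of all subsets of $X$ that can be covered by countably many hyperplanes of $X$, and $\mathfrak{cov}(X)$ is the minimal cardinality of a family of sets from $\mathcal{H}_\sigma(X)$ whose union is $X$. A biorthogonal system in $X$ is a family $(x_i,x_i^* )_{i\in I}$ with $x_i\in X$, $x_i^*\in X^*$ and $x_i^*(x_j)=\delta_{i,j}$; it is fundamental if the closed linear span of $\{x_i:i\in I\}$ is $X$. $C(K)$ is the Banach space of real continuous functions on $K$ with the supremum norm. $\ell_1(\omega_1)$ is the Banach space of functions $f:\omega_1\to\mathbb{R}$ with $\|f\|=\sum_{\alpha<\omega_1}|f(\alpha)|<\infty$. A compact Hausdorff space $K$ has countable tightness if whenever $x\in\overline{A}$ for $A\subseteq K$, there is a countable $B\subseteq A$ with $x\in\overline{B}$; it has uncountable tightness if it does not have countable tightness. *)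

theory Defs
  imports "HOL-Analysis.Analysis"
begin

unbundle cardinal_syntax
no_notation elt_set_eq (infix \<open>=o\<close> 50)

definition separable :: "'a::topological_space itself \<Rightarrow> bool"
  where "separable TYPE('a) \<longleftrightarrow> (\<exists>D::'a set. countable D \<and> closure D = UNIV)"


section \<open>Hyperplanes and the covering number\<close>

text \<open>The last conjunct says that the quotient by \<open>H\<close> is spanned by one nonzero vector,
  so \<open>H\<close> has codimension one.\<close>

definition hyperplane :: "'a::real_normed_vector set \<Rightarrow> bool"
  where "hyperplane H \<longleftrightarrow>
    subspace H \<and> closed H \<and> (\<exists>v. v \<notin> H \<and> span (insert v H) = UNIV)"

definition H_sigma :: "'a::real_normed_vector set set"
  where "H_sigma = {A. \<exists>\<H>. countable \<H> \<and> (\<forall>H\<in>\<H>. hyperplane H) \<and> A \<subseteq> \<Union>\<H>}"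

definition H_sigma_cover :: "'a::real_normed_vector set set \<Rightarrow> bool"
  where "H_sigma_cover \<F> \<longleftrightarrow> \<F> \<subseteq> H_sigma \<and> \<Union>\<F> = UNIV"

text \<open>The value is meaningful only if some cover exists (this fails exactly in dimension at
  most one, where no cardinal is assigned in the usual definition either); see the lemma below.\<close>

definition cov :: "'a::real_normed_vector itself \<Rightarrow> 'a set rel"
  where "cov TYPE('a) = card_of (SOME \<F>::'a set set.
    H_sigma_cover \<F> \<and> (\<forall>\<G>::'a set set. H_sigma_cover \<G> \<longrightarrow> card_of \<F> \<le>o card_of \<G>))"

lemma cov_minimal:
  fixes \<G> :: "'a::real_normed_vector set set"
  assumes "H_sigma_cover \<G>"
  shows "\<exists>\<F>::'a set set. H_sigma_cover \<F> \<and> cov TYPE('a) = card_of \<F>"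
    and "cov TYPE('a) \<le>o card_of \<G>"
proof -
  let ?P = "\<lambda>\<F>::'a set set. H_sigma_cover \<F> \<and>
    (\<forall>\<G>::'a set set. H_sigma_cover \<G> \<longrightarrow> card_of \<F> \<le>o card_of \<G>)"
  have "\<exists>r\<in>card_of ` Collect H_sigma_cover. \<forall>r'\<in>card_of ` Collect H_sigma_cover.
      (r :: 'a set rel) \<le>o (r' :: 'a set rel)"
    by (rule exists_minim_Card_order) (use assms card_of_Card_order in auto)
  then have "\<exists>\<F>. ?P \<F>" by auto
  then have *: "?P (SOME \<F>. ?P \<F>)" by (rule someI_ex)
  show "\<exists>\<F>::'a set set. H_sigma_cover \<F> \<and> cov TYPE('a) = card_of \<F>"
    using * unfolding cov_def by blast
  show "cov TYPE('a) \<le>o card_of \<G>"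
    using * assms unfolding cov_def by blast
qed


section \<open>Biorthogonal systems\<close>

definition biorthogonal_system ::
    "'i set \<Rightarrow> ('i \<Rightarrow> 'a::real_normed_vector) \<Rightarrow> ('i \<Rightarrow> 'a \<Rightarrow>\<^sub>L real) \<Rightarrow> bool"
  where "biorthogonal_system I x x' \<longleftrightarrow>
    (\<forall>i\<in>I. \<forall>j\<in>I. blinfun_apply (x' i) (x j) = (if i = j then 1 else 0))"

definition fundamental_biorthogonal_system ::
    "'i set \<Rightarrow> ('i \<Rightarrow> 'a::real_normed_vector) \<Rightarrow> ('i \<Rightarrow> 'a \<Rightarrow>\<^sub>L real) \<Rightarrow> bool"
  where "fundamental_biorthogonal_system I x x' \<longleftrightarrow>
    biorthogonal_system I x x' \<and> closure (span (x ` I)) = UNIV"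


section \<open>Topological notions\<close>

definition scattered :: "'k::topological_space set \<Rightarrow> bool"
  where "scattered S \<longleftrightarrow> (\<forall>A\<subseteq>S. A \<noteq> {} \<longrightarrow> (\<exists>x. x isolated_in A))"

definition countably_tight :: "'b topology \<Rightarrow> bool"
  where "countably_tight T \<longleftrightarrow>
    (\<forall>A x. A \<subseteq> topspace T \<and> x \<in> T closure_of A \<longrightarrow>
       (\<exists>B\<subseteq>A. countable B \<and> x \<in> T closure_of B))"

text \<open>For scalar-valued operators the strong operator topology is the topology of pointwise
  convergence on \<open>X\<close>, i.e. the weak* topology of the dual.\<close>

abbreviation weak_star_topology :: "('a::real_normed_vector \<Rightarrow>\<^sub>L real) topology"
  where "weak_star_topology \<equiv> strong_operator_topology"

definition dual_ball_weak_star :: "('a::real_normed_vector \<Rightarrow>\<^sub>L real) topology"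
  where "dual_ball_weak_star = subtopology weak_star_topology (cball 0 1)"


section \<open>Embeddings and isometries\<close>

definition isomorphic_embedding ::
    "('a::real_normed_vector \<Rightarrow> 'b::real_normed_vector) \<Rightarrow> bool"
  where "isomorphic_embedding T \<longleftrightarrow>
    bounded_linear T \<and> (\<exists>c>0. \<forall>x. c * norm x \<le> norm (T x))"

definition linear_isometry_onto ::
    "('a::real_normed_vector \<Rightarrow> 'b::real_normed_vector) \<Rightarrow> bool"
  where "linear_isometry_onto T \<longleftrightarrow> linear T \<and> surj T \<and> (\<forall>x. norm (T x) = norm x)"


section \<open>The first uncountable cardinal and \<open>\<ell>\<^sub>1\<close> spaces\<close>

abbreviation omega1_card :: "nat set rel"
  where "omega1_card \<equiv> cardSuc natLeq"

typedef omega1 = "Field omega1_card"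
proof -
  have "infinite (Field omega1_card)"
    using cardSuc_finite[OF natLeq_Card_order] by (simp add: Field_natLeq)
  then show ?thesis by (metis finite.emptyI ex_in_conv)
qed

typedef 'i ell1 = "{f :: 'i \<Rightarrow> real. (\<lambda>i. \<bar>f i\<bar>) summable_on UNIV}"
  by (rule exI[of _ "\<lambda>_. 0"]) simp

setup_lifting type_definition_ell1

instantiation ell1 :: (type) real_vector
begin

lift_definition zero_ell1 :: "'a ell1" is "\<lambda>_. 0" by simp

lift_definition plus_ell1 :: "'a ell1 \<Rightarrow> 'a ell1 \<Rightarrow> 'a ell1" is "\<lambda>f g i. f i + g i"
  using summable_on_add by (fastforce simp flip: real_norm_def summable_on_iff_abs_summable_on_real)

lift_definition uminus_ell1 :: "'a ell1 \<Rightarrow> 'a ell1" is "\<lambda>f i. - f i" by simp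

lift_definition minus_ell1 :: "'a ell1 \<Rightarrow> 'a ell1 \<Rightarrow> 'a ell1" is "\<lambda>f g i. f i - g i"
  subgoal for f g
    using summable_on_add[of f UNIV "\<lambda>i. - g i"]
    by (simp flip: real_norm_def summable_on_iff_abs_summable_on_real add: summable_on_uminus)
  done

lift_definition scaleR_ell1 :: "real \<Rightarrow> 'a ell1 \<Rightarrow> 'a ell1" is "\<lambda>c f i. c * f i"
  by (simp add: abs_mult summable_on_cmult_right)

instance
proof
  fix f g h :: "'a ell1" and a b :: real
  show "f + g + h = f + (g + h)" by transfer (simp add: add.assoc)
  show "f + g = g + f" by transfer (simp add: add.commute)
  show "0 + f = f" by transfer simp
  show "- f + f = 0" by transfer simp
  show "f - g = f + - g" by transfer simp
  show "a *\<^sub>R (f + g) = a *\<^sub>R f + a *\<^sub>R g" by transfer (simp add: algebra_simps)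
  show "(a + b) *\<^sub>R f = a *\<^sub>R f + b *\<^sub>R f" by transfer (simp add: algebra_simps)
  show "a *\<^sub>R b *\<^sub>R f = (a * b) *\<^sub>R f" by transfer (simp add: mult.assoc)
  show "1 *\<^sub>R f = f" by transfer simp
qed

end

instantiation ell1 :: (type) real_normed_vector
begin

lift_definition norm_ell1 :: "'a ell1 \<Rightarrow> real" is "\<lambda>f. \<Sum>\<^sub>\<infinity>i. \<bar>f i\<bar>" .

definition dist_ell1 :: "'a ell1 \<Rightarrow> 'a ell1 \<Rightarrow> real"
  where "dist_ell1 f g = norm (f - g)"

definition sgn_ell1 :: "'a ell1 \<Rightarrow> 'a ell1"
  where "sgn_ell1 f = f /\<^sub>R norm f"

definition uniformity_ell1 :: "('a ell1 \<times> 'a ell1) filter"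
  where "uniformity_ell1 = (INF e\<in>{0<..}. principal {(x, y). dist x y < e})"

definition open_ell1 :: "'a ell1 set \<Rightarrow> bool"
  where "open_ell1 U \<longleftrightarrow> (\<forall>x\<in>U. \<forall>\<^sub>F (x', y) in uniformity. x' = x \<longrightarrow> y \<in> U)"

instance
proof
  fix f g :: "'a ell1" and a :: real
  show "dist f g = norm (f - g)" by (rule dist_ell1_def)
  show "sgn f = f /\<^sub>R norm f" by (rule sgn_ell1_def)
  show "(uniformity :: ('a ell1 \<times> 'a ell1) filter) =
      (INF e\<in>{0<..}. principal {(x, y). dist x y < e})"
    by (rule uniformity_ell1_def)
  show "open U \<longleftrightarrow> (\<forall>x\<in>U. \<forall>\<^sub>F (x', y) in uniformity. x' = x \<longrightarrow> y \<in> U)"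
    for U :: "'a ell1 set"
    by (rule open_ell1_def)
  show "norm f = 0 \<longleftrightarrow> f = 0"
  proof
    assume "norm f = 0"
    then show "f = 0"
    proof transfer
      fix f :: "'a \<Rightarrow> real"
      assume "(\<lambda>i. \<bar>f i\<bar>) summable_on UNIV" and "(\<Sum>\<^sub>\<infinity>i. \<bar>f i\<bar>) = 0"
      then have "\<bar>f i\<bar> = 0" for i
        using nonneg_infsum_le_0D[of "\<lambda>i. \<bar>f i\<bar>" UNIV i] by simp
      then show "f = (\<lambda>_. 0)" by auto
    qed
  qed (transfer, simp)
  show "norm (f + g) \<le> norm f + norm g"
  proof transfer
    fix f g :: "'a \<Rightarrow> real"
    assume f: "(\<lambda>i. \<bar>f i\<bar>) summable_on UNIV" and g: "(\<lambda>i. \<bar>g i\<bar>) summable_on UNIV"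
    have "(\<lambda>i. \<bar>f i + g i\<bar>) summable_on UNIV"
      using f g summable_on_add[of f UNIV g]
      by (simp flip: real_norm_def summable_on_iff_abs_summable_on_real)
    then have "(\<Sum>\<^sub>\<infinity>i. \<bar>f i + g i\<bar>) \<le> (\<Sum>\<^sub>\<infinity>i. \<bar>f i\<bar> + \<bar>g i\<bar>)"
      using summable_on_add[OF f g] by (intro infsum_mono) auto
    also have "\<dots> = (\<Sum>\<^sub>\<infinity>i. \<bar>f i\<bar>) + (\<Sum>\<^sub>\<infinity>i. \<bar>g i\<bar>)"
      using infsum_add[OF f g] by simp
    finally show "(\<Sum>\<^sub>\<infinity>i. \<bar>f i + g i\<bar>) \<le> (\<Sum>\<^sub>\<infinity>i. \<bar>f i\<bar>) + (\<Sum>\<^sub>\<infinity>i. \<bar>g i\<bar>)" .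
  qed
  show "norm (a *\<^sub>R f) = \<bar>a\<bar> * norm f"
    by transfer (simp add: abs_mult infsum_cmult_right')
qed

end

end

theory Submission
  imports Defs "HOL-Library.Countable_Set_Type"
begin

text \<open>
  Every nonzero bounded functional has a hyperplane as its kernel, so it suffices to find at most
  \<open>\<omega>\<^sub>1\<close> nonzero functionals such that each vector is annihilated by one of them; that
  countably many hyperplanes never suffice, for the space or for the covering number, is Baire's
  theorem. The usual way to find the functionals is to have an uncountable family of nonzero functionals
  of which each vector is annihilated by all but countably many: any \<open>\<omega>\<^sub>1\<close> of them will do
  (lemma \<open>annihilating_cocountable_family\<close>). Each of the four hypotheses leads to
  such functionals.

  (1) The coordinate functionals of a fundamental biorthogonal system vanish, up to countably many,
  at each vector, because they do so up to finitely many on the span.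

  (2) A continuous real function on a scattered compact space has countable range, so among
  \<open>\<omega>\<^sub>1\<close> points of the space it takes some value twice; the differences of the
  evaluations at these points are the required functionals.

  (3) and (4) rest on bounded positive semidefinite bilinear forms. If such a form \<open>b\<close> is
  nonseparable, meaning that it has an uncountable uniformly separated set, then a maximal family of
  functionals satisfying Bessel's inequality for \<open>b\<close> is uncountable, and a square-summable
  family vanishes up to countably many members (lemma \<open>annihilating_family_of_nonseparable_form\<close>).
  A copy of \<open>\<ell>\<^sub>1\<close> over an uncountable index set carries a form for which the
  unit vectors are orthonormal: on finitely many unit vectors, average the rank-one forms of functionals
  with prescribed signs on them, and pass to a limit by compactness.

  For (4), uncountable tightness at \<open>0\<close> (after a translation) gives, by recursion over
  \<open>\<omega>\<^sub>1\<close>, functionals \<open>a \<alpha>\<close> and finite sets \<open>F \<alpha>\<close>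
  of vectors such that \<open>F \<alpha>\<close> separates every \<open>a \<beta>\<close> with
  \<open>\<beta> \<le> \<alpha>\<close> from \<open>0\<close> but all later \<open>a \<beta>\<close> vanish on
  \<open>F \<alpha>\<close>. The rank-one forms of the \<open>a \<alpha>\<close> and convexity lead to a compact set of
  limit forms, which vanish on all the sets \<open>F \<alpha>\<close>. If some limit form is nonseparable, the
  previous paragraph applies. Otherwise a maximality argument (lemma
  \<open>form_determining_set\<close>) gives a limit form \<open>\<mu>\<close> and a countable set
  \<open>D\<close> which is dense for every limit form that agrees with \<open>\<mu>\<close> on \<open>D\<close>.
  For each \<open>\<alpha>\<close> there is a form \<open>\<nu>\<close> in the tail beyond \<open>\<alpha>\<close> that agrees with \<open>\<mu>\<close>
  on \<open>D\<close> and is nonzero at some \<open>h\<close> where \<open>\<mu>\<close> is zero. Then \<open>h\<close> has positive distance from the span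
  of \<open>D\<close> for \<open>\<rho> = (\<nu> + \<mu>) / 2\<close>, so the Hahn-Banach theorem provides a
  nonzero functional \<open>\<phi> \<alpha>\<close> dominated by \<open>\<rho>\<close> and zero on \<open>D\<close>. A cluster point of these functionals along
  an uncountable set of indices is dominated by a limit form for which \<open>D\<close> is dense, while it vanishes
  on \<open>D\<close>; so it is zero. Hence each vector is annihilated by all but countably many of the
  \<open>\<phi> \<alpha>\<close>.
\<close>

section \<open>Covering a Banach space by kernels of functionals\<close>

definition annihilates :: "('a::real_normed_vector \<Rightarrow>\<^sub>L real) set \<Rightarrow> bool"
  where "annihilates \<Phi> \<longleftrightarrow> 0 \<notin> \<Phi> \<and> (\<forall>x. \<exists>\<phi>\<in>\<Phi>. blinfun_apply \<phi> x = 0)"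

lemma uncountable_iff_omega1_le: "\<not> countable A \<longleftrightarrow> omega1_card \<le>o card_of A"
proof -
  have "\<not> countable A \<longleftrightarrow> natLeq <o card_of A"
    unfolding countable_card_le_natLeq
    by (simp add: card_of_Well_order natLeq_Well_order not_ordLeq_iff_ordLess)
  also have "\<dots> \<longleftrightarrow> omega1_card \<le>o card_of A"
    by (rule cardSuc_ordLess_ordLeq[OF natLeq_Card_order card_of_Card_order])
  finally show ?thesis .
qed

lemma card_Field_omega1: "card_of (Field omega1_card) =o omega1_card"
  by (rule card_of_Field_ordIso[OF cardSuc_Card_order[OF natLeq_Card_order]])

lemma uncountable_Field_omega1: "\<not> countable (Field omega1_card)"
  using card_Field_omega1 uncountable_iff_omega1_le ordIso_iff_ordLeq by blast

lemma uncountable_obtains_omega1_subset: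
  assumes "\<not> countable J"
  obtains J' where "J' \<subseteq> J" "card_of J' =o omega1_card" "\<not> countable J'"
proof -
  have "card_of (Field omega1_card) \<le>o card_of J"
    using assms card_Field_omega1 ordIso_ordLeq_trans uncountable_iff_omega1_le by blast
  then obtain f where f: "inj_on f (Field omega1_card)" "f ` Field omega1_card \<subseteq> J"
    by (metis card_of_ordLeq)
  let ?J = "f ` Field omega1_card"
  have "card_of (Field omega1_card) =o card_of ?J"
    using f(1) card_of_ordIso inj_on_imp_bij_betw by blast
  then have "card_of ?J =o omega1_card"
    using card_Field_omega1 ordIso_symmetric ordIso_transitive by blast
  moreover from this have "\<not> countable ?J"
    using ordIso_iff_ordLeq uncountable_iff_omega1_le by blast
  ultimately show thesis using f(2) that by blast
qed

text \<open>
  Any uncountable subfamily meets the cocountably many members that annihilate a given vector, so one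
  of size \<open>\<omega>\<^sub>1\<close> is enough.
\<close>

lemma annihilating_cocountable_family:
  fixes \<phi> :: "'j \<Rightarrow> ('a::real_normed_vector \<Rightarrow>\<^sub>L real)"
  assumes J: "\<not> countable J" and nz: "\<And>j. j \<in> J \<Longrightarrow> \<phi> j \<noteq> 0"
    and null: "\<And>x. countable {j \<in> J. blinfun_apply (\<phi> j) x \<noteq> 0}"
  shows "\<exists>\<Phi>::('a \<Rightarrow>\<^sub>L real) set. annihilates \<Phi> \<and> card_of \<Phi> \<le>o omega1_card"
proof -
  obtain J' where J': "J' \<subseteq> J" "card_of J' =o omega1_card" "\<not> countable J'"
    using J by (rule uncountable_obtains_omega1_subset)
  have *: "\<exists>j\<in>J'. blinfun_apply (\<phi> j) x = 0" for x
    using J'(1,3) countable_subset[OF _ null[of x], of J'] by blast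
  have "annihilates (\<phi> ` J')"
    using nz J'(1) * unfolding annihilates_def by fastforce
  moreover have "card_of (\<phi> ` J') \<le>o omega1_card"
    by (rule ordLeq_ordIso_trans[OF card_of_image J'(2)])
  ultimately show ?thesis by blast
qed

lemma hyperplane_kernel:
  fixes \<phi> :: "'a::real_normed_vector \<Rightarrow>\<^sub>L real"
  assumes "\<phi> \<noteq> 0"
  shows "hyperplane {x. blinfun_apply \<phi> x = 0}"
proof -
  let ?H = "{x. blinfun_apply \<phi> x = 0}"
  obtain v where v: "blinfun_apply \<phi> v \<noteq> 0"
    using assms by (metis blinfun_eqI zero_blinfun.rep_eq)
  have "x \<in> span (insert v ?H)" for x
  proof -
    let ?c = "blinfun_apply \<phi> x / blinfun_apply \<phi> v"
    have "x - ?c *\<^sub>R v \<in> ?H"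
      using v by (simp add: blinfun.diff_right blinfun.scaleR_right)
    then have "(x - ?c *\<^sub>R v) + ?c *\<^sub>R v \<in> span (insert v ?H)"
      by (intro span_add span_scale span_base) auto
    then show ?thesis by simp
  qed
  moreover have "subspace ?H"
    by (auto simp: subspace_def blinfun.add_right blinfun.scaleR_right)
  moreover have "closed ?H"
    by (intro closed_Collect_eq continuous_intros)
  ultimately show ?thesis using v unfolding hyperplane_def by blast
qed

lemma hyperplane_empty_interior:
  assumes "hyperplane (H::'a::real_normed_vector set)"
  shows "interior H = {}"
proof (rule ccontr)
  assume "interior H \<noteq> {}"
  then obtain a e where ae: "e > 0" "ball a e \<subseteq> H"
    by (meson all_not_in_conv mem_interior)
  obtain v where v: "v \<notin> H" and sub: "subspace H" using assms unfolding hyperplane_def by blast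
  have "v \<noteq> 0" using v sub subspace_0 by blast
  let ?t = "e / (2 * norm v)"
  have t: "?t > 0" using ae \<open>v \<noteq> 0\<close> by simp
  have "a \<in> H" using ae by auto
  moreover have "a + ?t *\<^sub>R v \<in> H"
    using ae \<open>v \<noteq> 0\<close> by (intro set_mp[OF ae(2)]) (simp add: dist_norm)
  ultimately have "?t *\<^sub>R v \<in> H"
    using subspace_diff[OF sub] by (metis add_diff_cancel_left')
  then have "(1 / ?t) *\<^sub>R (?t *\<^sub>R v) \<in> H" by (rule subspace_scale[OF sub])
  moreover have "(1 / ?t) *\<^sub>R (?t *\<^sub>R v) = v" using ae(1) \<open>v \<noteq> 0\<close> by simp
  ultimately show False using v by simp
qed

text \<open>
  Baire's theorem: hyperplanes are closed with empty interior. This is where completeness of the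
  space enters.
\<close>

lemma not_countable_union_of_hyperplanes:
  assumes "countable \<H>" "\<forall>H\<in>\<H>. hyperplane H"
  shows "\<Union>\<H> \<noteq> (UNIV::'a::banach set)"
proof
  assume eq: "\<Union>\<H> = (UNIV::'a set)"
  have "closedin euclidean H \<and> euclidean interior_of H = {}" if "H \<in> \<H>" for H
    using assms(2) that hyperplane_empty_interior[of H] unfolding hyperplane_def by simp
  then have "euclidean interior_of (\<Union>\<H>) = {}"
    by (intro Baire_category_alt assms(1) disjI1 completely_metrizable_space_euclidean)
  then show False using eq by simp
qed

text \<open>
  The lower bounds on both cardinals are the same instance of Baire's theorem, because countably many
  members of \<open>H_sigma\<close> together need only countably many hyperplanes.
\<close>

lemma omega1_hyperplanes:
  fixes \<Phi> :: "('a::banach \<Rightarrow>\<^sub>L real) set"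
  assumes \<Phi>: "annihilates \<Phi>" "card_of \<Phi> \<le>o omega1_card"
  shows "(\<exists>\<H>::'a set set. (\<forall>H\<in>\<H>. hyperplane H) \<and> card_of \<H> =o omega1_card \<and> \<Union>\<H> = UNIV)
       \<and> cov TYPE('a) =o omega1_card"
proof -
  define \<H> where "\<H> = (\<lambda>\<phi>. {x::'a. blinfun_apply \<phi> x = 0}) ` \<Phi>"
  have hyp: "\<forall>H\<in>\<H>. hyperplane H"
    using \<Phi>(1) unfolding \<H>_def annihilates_def
    by (intro ballI) (elim imageE, hypsubst, rule hyperplane_kernel, metis)
  have un: "\<Union>\<H> = UNIV" using \<Phi>(1) unfolding \<H>_def annihilates_def by fastforce
  have "\<not> countable \<H>" using not_countable_union_of_hyperplanes hyp un by blast
  moreover have "card_of \<H> \<le>o omega1_card"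
    unfolding \<H>_def by (rule ordLeq_transitive[OF card_of_image \<Phi>(2)])
  ultimately have card: "card_of \<H> =o omega1_card"
    by (simp add: ordIso_iff_ordLeq uncountable_iff_omega1_le)
  have "\<H> \<subseteq> H_sigma"
  proof
    fix H assume "H \<in> \<H>"
    then show "H \<in> H_sigma"
      using hyp unfolding H_sigma_def by (intro CollectI exI[of _ "{H}"]) auto
  qed
  then have cover: "H_sigma_cover \<H>" using un unfolding H_sigma_cover_def by blast
  obtain \<F> where \<F>: "H_sigma_cover \<F>" "cov TYPE('a) = card_of \<F>"
    using cov_minimal(1)[OF cover] by (elim exE conjE)
  have "\<not> countable \<F>"
  proof
    assume cnt: "countable \<F>"
    have "\<exists>\<K>. countable \<K> \<and> (\<forall>H\<in>\<K>. hyperplane H) \<and> A \<subseteq> \<Union>\<K>" if "A \<in> \<F>" for A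
    proof -
      have "A \<in> H_sigma" using \<F>(1) that unfolding H_sigma_cover_def by blast
      then show ?thesis unfolding H_sigma_def by simp
    qed
    then obtain \<K> where \<K>: "\<And>A. A \<in> \<F> \<Longrightarrow>
        countable (\<K> A) \<and> (\<forall>H\<in>\<K> A. hyperplane H) \<and> A \<subseteq> \<Union>(\<K> A)"
      by metis
    have "countable (\<Union>(\<K> ` \<F>))" using cnt \<K> by (intro countable_UN) auto
    moreover have "\<forall>H\<in>\<Union>(\<K> ` \<F>). hyperplane H" using \<K> by fast
    ultimately have "\<Union>(\<Union>(\<K> ` \<F>)) \<noteq> UNIV" by (rule not_countable_union_of_hyperplanes)
    moreover have "x \<in> \<Union>(\<Union>(\<K> ` \<F>))" for x
    proof -
      obtain A where A: "A \<in> \<F>" "x \<in> A" using \<F>(1) unfolding H_sigma_cover_def by fast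
      then have "x \<in> \<Union>(\<K> A)" using \<K> by fast
      then show ?thesis using A(1) by fast
    qed
    ultimately show False by fast
  qed
  then have "omega1_card \<le>o cov TYPE('a)" unfolding \<F>(2) by (rule uncountable_iff_omega1_le[THEN iffD1])
  moreover have "cov TYPE('a) \<le>o omega1_card"
    by (rule ordLeq_ordIso_trans[OF cov_minimal(2)[OF cover] card])
  ultimately have "cov TYPE('a) =o omega1_card" by (simp add: ordIso_iff_ordLeq)
  then show ?thesis using hyp card un by blast
qed

section \<open>Cluster points and pointwise compactness\<close>

text \<open>
  A cluster point inherits every closed condition that holds eventually. The statement is for
  arbitrary filters because it serves sequences, nets over the finite sets and, through the filter
  below, uncountable index sets.
\<close>

lemma compact_filter_cluster:
  fixes p :: "'j \<Rightarrow> 'b::topological_space"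
  assumes K: "compact K" and F: "F \<noteq> bot" and ev: "eventually (\<lambda>j. p j \<in> K) F"
  shows "\<exists>q\<in>K. \<forall>T. closed T \<longrightarrow> eventually (\<lambda>j. p j \<in> T) F \<longrightarrow> q \<in> T"
proof -
  have "filtermap p F \<le> principal K"
    unfolding le_principal eventually_filtermap by (rule ev)
  moreover have "filtermap p F \<noteq> bot" using F by (simp add: filtermap_bot_iff)
  ultimately obtain q where q: "q \<in> K" "inf (nhds q) (filtermap p F) \<noteq> bot"
    using K unfolding compact_filter le_principal by metis
  have "q \<in> T" if T: "closed T" "eventually (\<lambda>j. p j \<in> T) F" for T
  proof (rule ccontr)
    assume "q \<notin> T"
    then have "eventually (\<lambda>x. x \<in> - T) (nhds q)"
      using T(1) by (intro eventually_nhds_in_open) auto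
    moreover have "eventually (\<lambda>x. x \<in> T) (filtermap p F)"
      using T(2) by (simp add: eventually_filtermap)
    ultimately have "eventually (\<lambda>x. False) (inf (nhds q) (filtermap p F))"
      unfolding eventually_inf by fastforce
    then show False using q(2) by (simp add: eventually_False)
  qed
  then show ?thesis using q(1) by blast
qed

text \<open>
  Along this filter, "eventually" means for all but countably many members of \<open>S\<close>.
\<close>

definition cocountable :: "'j set \<Rightarrow> 'j filter"
  where "cocountable S = (INF C\<in>{C. countable C}. principal (S - C))"

lemma eventually_cocountable:
  "eventually P (cocountable S) \<longleftrightarrow> countable {j \<in> S. \<not> P j}"
proof -
  have "eventually P (cocountable S) \<longleftrightarrow> (\<exists>C\<in>{C. countable C}. eventually P (principal (S - C)))"
    unfolding cocountable_def
  proof (rule eventually_INF_base)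
    show "\<exists>x\<in>{C. countable C}. principal (S - x) \<le> inf (principal (S - a)) (principal (S - b))"
      if "a \<in> {C. countable C}" "b \<in> {C. countable C}" for a b :: "'a set"
      using that by (intro bexI[of _ "a \<union> b"]) auto
  qed auto
  also have "\<dots> \<longleftrightarrow> countable {j \<in> S. \<not> P j}"
  proof
    assume "\<exists>C\<in>{C. countable C}. eventually P (principal (S - C))"
    then obtain C where "countable C" "\<forall>j\<in>S - C. P j" by (auto simp: eventually_principal)
    then show "countable {j \<in> S. \<not> P j}" by (auto elim: countable_subset[rotated])
  next
    assume "countable {j \<in> S. \<not> P j}"
    then show "\<exists>C\<in>{C. countable C}. eventually P (principal (S - C))"
      by (intro bexI[of _ "{j \<in> S. \<not> P j}"]) (auto simp: eventually_principal)
  qed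
  finally show ?thesis .
qed

lemma cocountable_neq_bot: "\<not> countable S \<Longrightarrow> cocountable S \<noteq> bot"
  using eventually_cocountable[of "\<lambda>_. False" S] unfolding eventually_False by auto

lemma compact_pointwise:
  fixes K :: "'i \<Rightarrow> 'b::topological_space set"
  assumes "\<And>i. compact (K i)"
  shows "compact {f. \<forall>i. f i \<in> K i}"
proof -
  have "compactin (product_topology (\<lambda>i. euclidean) UNIV) (PiE UNIV K)"
    using assms by (simp add: compactin_PiE)
  then show ?thesis by (simp add: euclidean_product_topology PiE_UNIV_domain Pi_def)
qed

lemma continuous_eval: "continuous_on UNIV (\<lambda>f::'i \<Rightarrow> 'b::topological_space. f i)"
  by simp

lemma continuous_eval2: "continuous_on UNIV (\<lambda>b::'i \<Rightarrow> 'j \<Rightarrow> 'b::topological_space. b i j)"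
  by (rule continuous_on_product_then_coordinatewise[OF continuous_eval])

lemma compact_functionals:
  "compact {g::'a::real_normed_vector \<Rightarrow> real. \<forall>x. g x \<in> {- (c * norm x)..c * norm x}}"
  by (rule compact_pointwise) auto

section \<open>The Hahn-Banach theorem\<close>

text \<open>
  Partial functionals are represented by their graphs, as subspaces of the product with the real line.
  Zorn's lemma then applies to subspaces, and no graph has to be shown single-valued on the way:
  domination by \<open>p\<close> forces all values at \<open>0\<close> to be \<open>0\<close>, since
  \<open>p 0 = 0\<close>. A maximal graph contains a pair \<open>(x, c)\<close> for every \<open>x\<close>, because
  subadditivity of \<open>p\<close> leaves room for an admissible value \<open>c\<close>.
\<close>

lemma dominated_graph_extension:
  fixes p :: "'a::real_vector \<Rightarrow> real" and G\<^sub>0 :: "('a \<times> real) set"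
  assumes add: "\<And>x y. p (x + y) \<le> p x + p y"
    and scale: "\<And>c x. 0 \<le> c \<Longrightarrow> p (c *\<^sub>R x) = c * p x"
    and G0: "subspace G\<^sub>0" "\<And>x r. (x, r) \<in> G\<^sub>0 \<Longrightarrow> r \<le> p x"
  obtains f where "linear f" "\<And>x. f x \<le> p x" "\<And>x r. (x, r) \<in> G\<^sub>0 \<Longrightarrow> f x = r"
proof -
  define \<A> where "\<A> = {G. subspace G \<and> G\<^sub>0 \<subseteq> G \<and> (\<forall>(x, r)\<in>G. r \<le> p x)}"
  have "\<exists>M\<in>\<A>. \<forall>X\<in>\<A>. M \<subseteq> X \<longrightarrow> X = M"
  proof (rule subset_Zorn_nonempty)
    show "\<A> \<noteq> {}" using G0 unfolding \<A>_def by blast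
  next
    fix \<C> assume C: "\<C> \<noteq> {}" "subset.chain \<A> \<C>"
    have in_A: "G \<in> \<A>" if "G \<in> \<C>" for G using C(2) that unfolding subset.chain_def by blast
    have "subspace (\<Union>\<C>)"
      unfolding subspace_def
    proof (intro conjI ballI allI)
      show "0 \<in> \<Union>\<C>" using C(1) in_A subspace_0 unfolding \<A>_def by blast
    next
      fix u v assume "u \<in> \<Union>\<C>" "v \<in> \<Union>\<C>"
      then obtain G where "G \<in> \<C>" "u \<in> G" "v \<in> G"
        using C(2) unfolding subset.chain_def by blast
      then show "u + v \<in> \<Union>\<C>" using in_A subspace_add unfolding \<A>_def by blast
    next
      fix c u assume "u \<in> \<Union>\<C>"
      then show "c *\<^sub>R u \<in> \<Union>\<C>" using in_A subspace_scale unfolding \<A>_def by blast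
    qed
    then show "\<Union>\<C> \<in> \<A>" using C(1) in_A unfolding \<A>_def by blast
  qed
  then obtain M where M: "M \<in> \<A>" and max: "\<And>X. X \<in> \<A> \<Longrightarrow> M \<subseteq> X \<Longrightarrow> X = M" by blast
  have sub: "subspace M" and ext: "G\<^sub>0 \<subseteq> M" and dom: "\<And>x r. (x, r) \<in> M \<Longrightarrow> r \<le> p x"
    using M unfolding \<A>_def by auto
  have Madd: "(x + y, r + s) \<in> M" if "(x, r) \<in> M" "(y, s) \<in> M" for x y r s
    using subspace_add[OF sub that] by simp
  have Mscale: "(c *\<^sub>R x, c * r) \<in> M" if "(x, r) \<in> M" for x r c
    using subspace_scale[OF sub that, of c] by simp
  have M0: "(0, 0) \<in> M" using subspace_0[OF sub] by (simp add: zero_prod_def)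
  have total: "\<exists>c. (x, c) \<in> M" for x
  proof -
    \<comment> \<open>Domination at \<open>y - x\<close> bounds an admissible value at \<open>x\<close> from below, domination at
      \<open>z + x\<close> from above; the largest lower bound is taken.\<close>
    let ?L = "{r - p (y - x) | y r. (y, r) \<in> M}"
    have bnd: "r - p (y - x) \<le> p (z + x) - s" if "(y, r) \<in> M" "(z, s) \<in> M" for y r z s
    proof -
      have "r + s \<le> p ((y - x) + (z + x))" using dom[OF Madd[OF that]] by simp
      also have "\<dots> \<le> p (y - x) + p (z + x)" by (rule add)
      finally show ?thesis by simp
    qed
    define c where "c = Sup ?L"
    have ne: "?L \<noteq> {}" using M0 by blast
    have bdd: "bdd_above ?L" using bnd[OF _ M0] by (intro bdd_aboveI[of _ "p (0 + x) - 0"]) auto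
    have lo: "r - c \<le> p (y - x)" if "(y, r) \<in> M" for y r
    proof -
      have "r - p (y - x) \<le> c" unfolding c_def by (rule cSup_upper[OF _ bdd]) (use that in blast)
      then show ?thesis by simp
    qed
    have hi: "s + c \<le> p (z + x)" if "(z, s) \<in> M" for z s
    proof -
      have "c \<le> p (z + x) - s" unfolding c_def
        by (rule cSup_least[OF ne]) (use bnd[OF _ that] in blast)
      then show ?thesis by simp
    qed
    let ?M = "{u + v | u v. u \<in> M \<and> v \<in> span {(x, c)}}"
    have MM: "M \<subseteq> ?M"
    proof
      fix u assume "u \<in> M"
      moreover have "u = u + 0" by simp
      ultimately show "u \<in> ?M" using span_zero by blast
    qed
    have "?M \<in> \<A>"
      unfolding \<A>_def
    proof (intro CollectI conjI)
      show "subspace ?M" by (rule subspace_sums[OF sub subspace_span])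
      show "G\<^sub>0 \<subseteq> ?M" using ext MM by (rule order_trans)
      show "\<forall>(y, r)\<in>?M. r \<le> p y"
      proof clarify
        fix y r a b z s
        assume ys: "(y, r) = (z, s) + (a, b)" "(z, s) \<in> M" "(a, b) \<in> span {(x, c)}"
        then obtain k where "(a, b) = k *\<^sub>R (x, c)" by (auto simp: span_singleton)
        then have y: "y = z + k *\<^sub>R x" and r: "r = s + k * c" using ys(1) by auto
        show "r \<le> p y"
        proof (cases k "0::real" rule: linorder_cases)
          case equal
          then show ?thesis using dom[OF ys(2)] y r by simp
        next
          case greater
          have "s / k + c \<le> p ((1 / k) *\<^sub>R z + x)" using hi[OF Mscale[OF ys(2), of "1 / k"]] by simp
          then have "k * (s / k + c) \<le> k * p ((1 / k) *\<^sub>R z + x)" using greater by simp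
          also have "\<dots> = p y"
            using greater y by (simp add: scaleR_add_right flip: scale)
          finally show ?thesis using greater r by (simp add: distrib_left)
        next
          case less
          have "s / (- k) - c \<le> p ((1 / (- k)) *\<^sub>R z - x)"
            using lo[OF Mscale[OF ys(2), of "1 / (- k)"]] by simp
          then have "(- k) * (s / (- k) - c) \<le> (- k) * p ((1 / (- k)) *\<^sub>R z - x)"
            using less by (intro mult_left_mono) auto
          also have "\<dots> = p ((- k) *\<^sub>R ((1 / (- k)) *\<^sub>R z - x))" using less by (intro scale[symmetric]) simp
          also have "(- k) *\<^sub>R ((1 / (- k)) *\<^sub>R z - x) = y"
            using less y by (simp add: scaleR_diff_right)
          finally show ?thesis using less r by (simp add: right_diff_distrib)
        qed
      qed
    qed
    then have "?M = M" using MM by (rule max)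
    moreover have "(0, 0) + (x, c) \<in> ?M" using M0 by (blast intro: span_base)
    ultimately have "(0, 0) + (x, c) \<in> M" by (rule subst)
    then show ?thesis by auto
  qed
  have single: "r = s" if "(x, r) \<in> M" "(x, s) \<in> M" for x r s
  proof -
    have le0: "t \<le> 0" if "(0, t) \<in> M" for t using dom[OF that] scale[of 0 0] by simp
    have "(0, r - s) \<in> M" "(0, s - r) \<in> M"
      using Madd[OF that(1) Mscale[OF that(2), of "-1"]]
        Madd[OF that(2) Mscale[OF that(1), of "-1"]] by simp_all
    then show ?thesis using le0[of "r - s"] le0[of "s - r"] by linarith
  qed
  define f where "f x = (THE r. (x, r) \<in> M)" for x
  have fM: "(x, f x) \<in> M" for x
    unfolding f_def by (rule theI') (use total single in blast)
  have "linear f"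
  proof (rule linearI)
    show "f (x + y) = f x + f y" for x y by (rule single[OF fM Madd[OF fM fM]])
    show "f (c *\<^sub>R x) = c *\<^sub>R f x" for c x
      using single[OF fM Mscale[OF fM]] by simp
  qed
  then show thesis using that fM dom single ext by blast
qed

lemma dominated_functional:
  fixes p :: "'a::real_normed_vector \<Rightarrow> real" and G\<^sub>0 :: "('a \<times> real) set"
  assumes add: "\<And>x y. p (x + y) \<le> p x + p y"
    and scale: "\<And>c x. p (c *\<^sub>R x) = \<bar>c\<bar> * p x"
    and bound: "\<And>x. p x \<le> C * norm x"
    and G0: "subspace G\<^sub>0" "\<And>x r. (x, r) \<in> G\<^sub>0 \<Longrightarrow> r \<le> p x"
  obtains \<phi> :: "'a \<Rightarrow>\<^sub>L real" where "\<And>x. \<bar>blinfun_apply \<phi> x\<bar> \<le> p x"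
    "\<And>x r. (x, r) \<in> G\<^sub>0 \<Longrightarrow> blinfun_apply \<phi> x = r"
proof -
  obtain f where f: "linear f" "\<And>x. f x \<le> p x" "\<And>x r. (x, r) \<in> G\<^sub>0 \<Longrightarrow> f x = r"
    using dominated_graph_extension[of p G\<^sub>0] add scale G0 by (metis abs_of_nonneg)
  have abs: "\<bar>f x\<bar> \<le> p x" for x
    using f(2)[of x] f(2)[of "- x"] linear_neg[OF f(1), of x] scale[of "-1" x] by auto
  have "bounded_linear f"
    using f(1) abs bound
    by (intro bounded_linear_intro[where K = C])
      (auto simp: linear_add linear_scale mult.commute intro: order_trans)
  then show thesis
    using that[of "Blinfun f"] abs f(3) by (simp add: bounded_linear_Blinfun_apply)
qed

section \<open>Bounded positive semidefinite forms\<close>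

definition form :: "real \<Rightarrow> ('a::real_normed_vector \<Rightarrow> 'a \<Rightarrow> real) \<Rightarrow> bool"
  where "form C b \<longleftrightarrow> bilinear b \<and> (\<forall>x y. b x y = b y x) \<and>
    (\<forall>x. 0 \<le> b x x \<and> b x x \<le> C * (norm x)\<^sup>2)"

lemma formD:
  assumes "form C b"
  shows "bilinear b" "b x y = b y x" "0 \<le> b x x" "b x x \<le> C * (norm x)\<^sup>2"
  using assms unfolding form_def by blast+

lemma form_square_add:
  assumes "form C b"
  shows "b (x + c *\<^sub>R y) (x + c *\<^sub>R y) = b x x + 2 * c * b x y + c\<^sup>2 * b y y"
  using formD(1)[OF assms] formD(2)[OF assms, of y x]
  by (simp add: bilinear_ladd bilinear_radd bilinear_lmul bilinear_rmul algebra_simps power2_eq_square)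

lemma form_square_diff:
  assumes "form C b"
  shows "b (x - y) (x - y) = b x x - 2 * b x y + b y y"
  using form_square_add[OF assms, of x "- 1" y] by simp

lemma form_scale:
  assumes "form C b"
  shows "b (c *\<^sub>R x) (c *\<^sub>R x) = c\<^sup>2 * b x x"
  using bilinear_lmul[OF formD(1)[OF assms]] bilinear_rmul[OF formD(1)[OF assms]]
  by (simp add: power2_eq_square)

lemma form_Cauchy_Schwarz:
  assumes "form C b"
  shows "(b x y)\<^sup>2 \<le> b x x * b y y"
proof (cases "b y y = 0")
  case True
  have "b x y = 0"
  proof (rule ccontr)
    assume ne: "b x y \<noteq> 0"
    \<comment> \<open>Along the null vector \<open>y\<close> the form is affine; this point makes it negative.\<close>
    let ?c = "- (b x x + 1) / (2 * b x y)"
    have "0 \<le> b x x + 2 * ?c * b x y + ?c\<^sup>2 * b y y"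
      using formD(3)[OF assms] form_square_add[OF assms] by metis
    then have "0 \<le> b x x - (b x x + 1)" using True ne by (simp add: field_simps)
    then show False by simp
  qed
  then show ?thesis using True by simp
next
  case False
  then have pos: "b y y > 0" using formD(3)[OF assms, of y] by simp
  \<comment> \<open>The minimum of the quadratic polynomial in \<open>c\<close>.\<close>
  let ?c = "- b x y / b y y"
  have "0 \<le> b x x + 2 * ?c * b x y + ?c\<^sup>2 * b y y"
    using formD(3)[OF assms] form_square_add[OF assms] by metis
  also have "\<dots> = b x x - (b x y)\<^sup>2 / b y y"
    using pos by (simp add: power2_eq_square field_simps)
  finally show ?thesis using pos by (simp add: field_simps)
qed

lemma form_abs_le:
  assumes "form C b"
  shows "\<bar>b x y\<bar> \<le> \<bar>C\<bar> * norm x * norm y"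
proof (rule power2_le_imp_le)
  have le: "b z z \<le> \<bar>C\<bar> * (norm z)\<^sup>2" for z
    by (rule order_trans[OF formD(4)[OF assms]]) (simp add: mult_right_mono)
  have "b x x * b y y \<le> (\<bar>C\<bar> * (norm x)\<^sup>2) * (\<bar>C\<bar> * (norm y)\<^sup>2)"
    using formD(3)[OF assms] le by (intro mult_mono) auto
  then show "\<bar>b x y\<bar>\<^sup>2 \<le> (\<bar>C\<bar> * norm x * norm y)\<^sup>2"
    using form_Cauchy_Schwarz[OF assms, of x y]
    by (simp add: power_mult_distrib power2_eq_square algebra_simps)
qed auto

lemma form_sqrt_triangle:
  assumes "form C b"
  shows "sqrt (b (x + y) (x + y)) \<le> sqrt (b x x) + sqrt (b y y)"
proof (rule real_le_lsqrt)
  have "b x y \<le> sqrt (b x x) * sqrt (b y y)"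
    using real_le_rsqrt[OF form_Cauchy_Schwarz[OF assms, of x y]] by (simp add: real_sqrt_mult)
  then show "b (x + y) (x + y) \<le> (sqrt (b x x) + sqrt (b y y))\<^sup>2"
    using form_square_add[OF assms, of x 1 y] formD(3)[OF assms] by (simp add: power2_sum)
  show "0 \<le> sqrt (b x x) + sqrt (b y y)" using formD(3)[OF assms] by (intro add_nonneg_nonneg) simp_all
qed

lemma form_diff_le:
  assumes "form C b"
  shows "b (x - y) (x - y) \<le> 2 * b x x + 2 * b y y"
proof -
  have "0 \<le> b (x + y) (x + y)" by (rule formD(3)[OF assms])
  then show ?thesis
    using form_square_add[OF assms, of x 1 y] form_square_add[OF assms, of x "-1" y] by simp
qed

lemma form_commute_diff:
  assumes "form C b"
  shows "b (x - y) (x - y) = b (y - x) (y - x)"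
  using form_scale[OF assms, of "-1" "x - y"] by simp

lemma closed_form: "closed {b::'a::real_normed_vector \<Rightarrow> 'a \<Rightarrow> real. form C b}"
proof -
  have "form C b \<longleftrightarrow> (\<forall>x y z. b (x + y) z = b x z + b y z) \<and> (\<forall>c x y. b (c *\<^sub>R x) y = c * b x y) \<and>
      (\<forall>x y. b x y = b y x) \<and> (\<forall>x. 0 \<le> b x x) \<and> (\<forall>x. b x x \<le> C * (norm x)\<^sup>2)" (is "_ \<longleftrightarrow> ?R b")
    for b :: "'a \<Rightarrow> 'a \<Rightarrow> real"
  proof
    assume b: "form C b"
    show "?R b"
      using bilinear_ladd[OF formD(1)[OF b]] bilinear_lmul[OF formD(1)[OF b]] formD(2-4)[OF b]
      by (intro conjI allI) auto
  next
    assume R: "?R b"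
    have "b z (x + y) = b z x + b z y" "b y (c *\<^sub>R x) = c * b y x" for x y z c
      using R by metis+
    then show "form C b" using R unfolding form_def bilinear_def by (auto intro!: linearI)
  qed
  then show ?thesis
    by (simp only:) (intro closed_Collect_conj closed_Collect_all closed_Collect_eq closed_Collect_le
        continuous_intros continuous_eval2)
qed

text \<open>
  The Cauchy-Schwarz inequality bounds every value \<open>b x y\<close> in terms of \<open>C\<close>, so
  Tychonoff's theorem applies.
\<close>

lemma compact_form: "compact {b::'a::real_normed_vector \<Rightarrow> 'a \<Rightarrow> real. form C b}"
proof -
  let ?box = "{b::'a \<Rightarrow> 'a \<Rightarrow> real. \<forall>x. b x \<in>
      {f. \<forall>y. f y \<in> {- (\<bar>C\<bar> * norm x * norm y)..\<bar>C\<bar> * norm x * norm y}}}"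
  have "compact ?box" by (intro compact_pointwise) auto
  then have "compact (?box \<inter> {b. form C b})" using closed_form by (rule compact_Int_closed)
  also have "?box \<inter> {b. form C b} = {b. form C b}"
    using abs_le_D1[OF form_abs_le] abs_le_D2[OF form_abs_le] by (auto simp: minus_le_iff)
  finally show ?thesis .
qed

text \<open>
  Used to remove from a form the part explained by a family of functionals; the remainder is again
  subject to the Cauchy-Schwarz inequality.
\<close>

lemma form_minus:
  assumes b: "form C b" and q: "bilinear q" "\<And>x y. q x y = q y x"
    and le: "\<And>x. 0 \<le> q x x" "\<And>x. q x x \<le> b x x"
  shows "form C (\<lambda>x y. b x y - q x y)"
  unfolding form_def
proof (intro conjI allI)
  show "bilinear (\<lambda>x y. b x y - q x y)"
    using formD(1)[OF b] q(1) unfolding bilinear_def by (auto intro: linear_compose_sub)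
  show "b x y - q x y = b y x - q y x" for x y using formD(2)[OF b, of x y] q(2)[of x y] by simp
  show "0 \<le> b x x - q x x" for x using le(2)[of x] by simp
  show "b x x - q x x \<le> C * (norm x)\<^sup>2" for x
    using le(1)[of x] formD(4)[OF b, of x] by linarith
qed

section \<open>Nonseparable forms and Bessel's inequality\<close>

text \<open>
  A family is a set of functionals here, so that Zorn's lemma can be applied to inclusion; nonzero
  members are required because the members will be used as kernels of hyperplanes.
\<close>

definition bessel :: "('a::real_normed_vector \<Rightarrow> 'a \<Rightarrow> real) \<Rightarrow> ('a \<Rightarrow>\<^sub>L real) set \<Rightarrow> bool"
  where "bessel b \<Phi> \<longleftrightarrow> 0 \<notin> \<Phi> \<and>
    (\<forall>F x. finite F \<and> F \<subseteq> \<Phi> \<longrightarrow> (\<Sum>\<phi>\<in>F. (blinfun_apply \<phi> x)\<^sup>2) \<le> b x x)"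

lemma bessel_summable:
  assumes "bessel b \<Phi>"
  shows "(\<lambda>\<phi>. blinfun_apply \<phi> x * blinfun_apply \<phi> y) summable_on \<Phi>"
proof -
  have sq: "(\<lambda>\<phi>. (blinfun_apply \<phi> z)\<^sup>2) summable_on \<Phi>" for z
    using assms unfolding bessel_def
    by (intro nonneg_bdd_above_summable_on bdd_aboveI[of _ "b z z"]) auto
  have "(\<lambda>\<phi>. \<bar>blinfun_apply \<phi> x * blinfun_apply \<phi> y\<bar>) summable_on \<Phi>"
  proof (rule summable_on_comparison_test)
    show "(\<lambda>\<phi>. (blinfun_apply \<phi> x)\<^sup>2 + (blinfun_apply \<phi> y)\<^sup>2) summable_on \<Phi>"
      by (intro summable_on_add sq)
    show "\<bar>s * t\<bar> \<le> s\<^sup>2 + t\<^sup>2" for s t :: real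
    proof -
      have "2 * \<bar>s * t\<bar> \<le> s\<^sup>2 + t\<^sup>2"
        using zero_le_power2[of "\<bar>s\<bar> - \<bar>t\<bar>"] by (simp add: power2_diff abs_mult)
      then show ?thesis by simp
    qed
  qed auto
  then show ?thesis by (simp flip: real_norm_def summable_on_iff_abs_summable_on_real)
qed

text \<open>
  The values at a fixed vector are square-summable.
\<close>

lemma bessel_countable_support:
  assumes "bessel b \<Phi>"
  shows "countable {\<phi> \<in> \<Phi>. blinfun_apply \<phi> x \<noteq> 0}"
proof -
  have "countable {\<phi> \<in> \<Phi>. blinfun_apply \<phi> x * blinfun_apply \<phi> x \<noteq> 0}"
    using bessel_summable[OF assms, of x x] by (rule summable_countable_real)
  then show ?thesis by simp
qed

text \<open>
  If equality failed at \<open>x\<close>, the remainder \<open>d\<close> of \<open>b\<close> after removing the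
  family would satisfy \<open>d x x > 0\<close>. By the Cauchy-Schwarz inequality the normalised functional
  \<open>d _ x / sqrt (d x x)\<close> is dominated by \<open>d\<close>, so it could be added to the family.
  Working with the remainder avoids completing the semi-inner-product space given by \<open>b\<close>.
\<close>

lemma maximal_bessel_parseval:
  assumes b: "form C b" and \<Phi>: "bessel b \<Phi>" and cnt: "countable \<Phi>"
    and max: "\<And>\<Psi>. bessel b \<Psi> \<Longrightarrow> \<Phi> \<subseteq> \<Psi> \<Longrightarrow> \<Psi> = \<Phi>"
  shows "b x x = (\<Sum>\<^sub>\<infinity>\<phi>\<in>\<Phi>. blinfun_apply \<phi> x * blinfun_apply \<phi> x)"
proof (rule ccontr)
  assume neq: "\<not> ?thesis"
  define Q where "Q y z = (\<Sum>\<^sub>\<infinity>\<phi>\<in>\<Phi>. blinfun_apply \<phi> y * blinfun_apply \<phi> z)" for y z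
  note summ = bessel_summable[OF \<Phi>]
  have Q_sym: "Q y z = Q z y" for y z unfolding Q_def by (simp add: mult.commute)
  have Q_lin: "linear (\<lambda>y. Q y z)" for z
  proof (rule linearI)
    show "Q (y + y') z = Q y z + Q y' z" for y y'
      unfolding Q_def by (simp add: blinfun.add_right distrib_right infsum_add[OF summ summ])
    show "Q (c *\<^sub>R y) z = c *\<^sub>R Q y z" for c y
      unfolding Q_def by (simp add: blinfun.scaleR_right mult.assoc infsum_cmult_right')
  qed
  have Q_eq: "(\<lambda>z. Q y z) = (\<lambda>z. Q z y)" for y by (rule ext) (rule Q_sym)
  have "linear (\<lambda>z. Q y z)" for y unfolding Q_eq[of y] by (rule Q_lin)
  then have Q_bil: "bilinear Q" unfolding bilinear_def by (intro conjI allI Q_lin)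
  have Q_nonneg: "0 \<le> Q y y" for y unfolding Q_def by (rule infsum_nonneg) simp
  have Q_le: "Q y y \<le> b y y" for y
    unfolding Q_def using \<Phi>
    by (intro infsum_le_finite_sums summ) (simp add: bessel_def flip: power2_eq_square)
  define d where "d y z = b y z - Q y z" for y z
  have d: "form C d" unfolding d_def by (rule form_minus[OF b Q_bil Q_sym Q_nonneg Q_le])
  have "d x x \<noteq> 0" using neq unfolding d_def Q_def by simp
  then have pos: "d x x > 0" using formD(3)[OF d, of x] by simp
  define f where "f y = d y x / sqrt (d x x)" for y
  have f_sq: "(f y)\<^sup>2 \<le> d y y" for y
    using form_Cauchy_Schwarz[OF d, of y x] pos
    unfolding f_def by (simp add: power_divide field_simps)
  have "linear f"
    using formD(1)[OF d] unfolding f_def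
    by (intro linearI) (simp_all add: bilinear_ladd bilinear_lmul add_divide_distrib)
  moreover have "\<bar>f y\<bar> \<le> norm y * sqrt \<bar>C\<bar>" for y
  proof (rule power2_le_imp_le)
    have "(f y)\<^sup>2 \<le> C * (norm y)\<^sup>2" by (rule order_trans[OF f_sq formD(4)[OF d]])
    also have "\<dots> \<le> \<bar>C\<bar> * (norm y)\<^sup>2" by (simp add: mult_right_mono)
    finally show "\<bar>f y\<bar>\<^sup>2 \<le> (norm y * sqrt \<bar>C\<bar>)\<^sup>2" by (simp add: power_mult_distrib mult.commute)
  qed simp
  ultimately have "bounded_linear f"
    by (intro bounded_linear_intro[where K = "sqrt \<bar>C\<bar>"]) (auto simp: linear_add linear_scale)
  then have app: "blinfun_apply (Blinfun f) = f" by (rule bounded_linear_Blinfun_apply)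
  have fx: "f x \<noteq> 0" using pos unfolding f_def by simp
  then have nz: "Blinfun f \<noteq> 0" using app by auto
  \<comment> \<open>Scaling makes the added functional different from all members of the countable set \<open>\<Phi>\<close>.\<close>
  have "\<exists>c\<in>{0<..<1}. c *\<^sub>R Blinfun f \<notin> \<Phi>"
  proof (rule ccontr)
    assume "\<not> ?thesis"
    then have "(\<lambda>c. c *\<^sub>R Blinfun f) ` {0<..<1} \<subseteq> \<Phi>" by blast
    then have "countable ((\<lambda>c. c *\<^sub>R Blinfun f) ` {0<..<1})" using cnt countable_subset by blast
    moreover have "inj_on (\<lambda>c. c *\<^sub>R Blinfun f) {0<..<1}" using nz by (auto simp: inj_on_def)
    ultimately have "countable {0<..<1::real}" by (simp add: countable_image_inj_eq)
    then show False using uncountable_open_interval[of "0::real" 1] by simp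
  qed
  then obtain c where c: "0 < c" "c < 1" "c *\<^sub>R Blinfun f \<notin> \<Phi>" by auto
  let ?\<psi> = "c *\<^sub>R Blinfun f"
  have \<psi>_sq: "(blinfun_apply ?\<psi> y)\<^sup>2 \<le> d y y" for y
  proof -
    have "(blinfun_apply ?\<psi> y)\<^sup>2 = c\<^sup>2 * (f y)\<^sup>2"
      by (simp add: blinfun.scaleR_left app power_mult_distrib)
    also have "\<dots> \<le> 1 * (f y)\<^sup>2" using c by (intro mult_right_mono) (auto simp: power_le_one)
    finally show ?thesis using f_sq[of y] by simp
  qed
  have "bessel b (insert ?\<psi> \<Phi>)"
    unfolding bessel_def
  proof (intro conjI allI impI)
    show "0 \<notin> insert ?\<psi> \<Phi>" using \<Phi> nz c unfolding bessel_def by auto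
  next
    fix F y assume F: "finite F \<and> F \<subseteq> insert ?\<psi> \<Phi>"
    have "(\<Sum>\<phi>\<in>F. (blinfun_apply \<phi> y)\<^sup>2) \<le> (\<Sum>\<phi>\<in>insert ?\<psi> (F - {?\<psi>}). (blinfun_apply \<phi> y)\<^sup>2)"
      using F by (intro sum_mono2) auto
    also have "\<dots> = (blinfun_apply ?\<psi> y)\<^sup>2 + (\<Sum>\<phi>\<in>F - {?\<psi>}. blinfun_apply \<phi> y * blinfun_apply \<phi> y)"
      using F by (subst sum.insert) (auto simp: power2_eq_square)
    also have "\<dots> \<le> d y y + Q y y"
      unfolding Q_def using F by (intro add_mono \<psi>_sq finite_sum_le_infsum summ) auto
    finally show "(\<Sum>\<phi>\<in>F. (blinfun_apply \<phi> y)\<^sup>2) \<le> b y y" unfolding d_def by simp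
  qed
  then have "insert ?\<psi> \<Phi> = \<Phi>" by (rule max) blast
  then show False using c(3) by blast
qed

text \<open>
  Finitely many members of \<open>\<Phi>\<close> explain a given vector up to a small error. Countably many
  data record which members these are and, approximately, their values; two vectors with the same data are
  close with respect to \<open>b\<close>.
\<close>

lemma countable_separated_if_parseval:
  fixes \<Phi> :: "('a::real_normed_vector \<Rightarrow>\<^sub>L real) set"
  assumes b: "form C b" and \<Phi>: "bessel b \<Phi>" and cnt: "countable \<Phi>"
    and eq: "\<And>x. b x x = (\<Sum>\<^sub>\<infinity>\<phi>\<in>\<Phi>. blinfun_apply \<phi> x * blinfun_apply \<phi> x)"
    and \<epsilon>: "\<epsilon> > 0" and sep: "\<And>x y. x \<in> E \<Longrightarrow> y \<in> E \<Longrightarrow> x \<noteq> y \<Longrightarrow> \<epsilon> \<le> b (x - y) (x - y)"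
  shows "countable E"
proof -
  define q where "q F x y = (\<Sum>\<phi>\<in>F. blinfun_apply \<phi> x * blinfun_apply \<phi> y)" for F :: "('a \<Rightarrow>\<^sub>L real) set" and x y
  have "\<exists>F. finite F \<and> F \<subseteq> \<Phi> \<and> b x x - q F x x < \<epsilon> / 8" for x
  proof -
    have "((\<lambda>\<phi>. blinfun_apply \<phi> x * blinfun_apply \<phi> x) has_sum b x x) \<Phi>"
      unfolding eq by (rule has_sum_infsum[OF bessel_summable[OF \<Phi>]])
    then have "((\<lambda>F. q F x x) \<longlongrightarrow> b x x) (finite_subsets_at_top \<Phi>)"
      unfolding has_sum_def q_def .
    from order_tendstoD(1)[OF this, of "b x x - \<epsilon> / 8"] \<epsilon>
    have "\<forall>\<^sub>F F in finite_subsets_at_top \<Phi>. b x x - \<epsilon> / 8 < q F x x" by simp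
    then obtain F where "finite F" "F \<subseteq> \<Phi>" "b x x - \<epsilon> / 8 < q F x x"
      unfolding eventually_finite_subsets_at_top by (metis order_refl)
    then show ?thesis by (intro exI[of _ F]) simp
  qed
  then obtain F where F: "\<And>x. finite (F x)" "\<And>x. F x \<subseteq> \<Phi>" "\<And>x. b x x - q (F x) x x < \<epsilon> / 8"
    by metis
  \<comment> \<open>Rounding values to multiples of \<open>\<delta> G\<close> changes the sum of squares over \<open>G\<close> by at most
    \<open>\<epsilon> / 4\<close>; the \<open>1\<close> covers the empty set.\<close>
  define \<delta> where "\<delta> G = sqrt (\<epsilon> / (4 * real (card G + 1)))" for G :: "('a \<Rightarrow>\<^sub>L real) set"
  have \<delta>: "\<delta> G > 0" for G using \<epsilon> unfolding \<delta>_def by simp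
  define k where "k x = (F x, restrict (\<lambda>\<phi>. \<lfloor>blinfun_apply \<phi> x / \<delta> (F x)\<rfloor>) (F x))" for x
  have inj: "inj_on k E"
  proof (rule inj_onI, rule ccontr)
    fix x y assume xy: "x \<in> E" "y \<in> E" "k x = k y" "x \<noteq> y"
    let ?F = "F x"
    have Fy: "F y = ?F" using xy(3) unfolding k_def by simp
    have close: "(blinfun_apply \<phi> (x - y))\<^sup>2 \<le> (\<delta> ?F)\<^sup>2" if "\<phi> \<in> ?F" for \<phi>
    proof -
      have "restrict (\<lambda>\<phi>. \<lfloor>blinfun_apply \<phi> x / \<delta> ?F\<rfloor>) ?F \<phi> = restrict (\<lambda>\<phi>. \<lfloor>blinfun_apply \<phi> y / \<delta> ?F\<rfloor>) ?F \<phi>"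
        using xy(3) Fy unfolding k_def by simp
      then have "\<lfloor>blinfun_apply \<phi> x / \<delta> ?F\<rfloor> = \<lfloor>blinfun_apply \<phi> y / \<delta> ?F\<rfloor>" using that by simp
      then have "\<bar>blinfun_apply \<phi> x / \<delta> ?F - blinfun_apply \<phi> y / \<delta> ?F\<bar> < 1" by linarith
      then have "\<bar>blinfun_apply \<phi> (x - y)\<bar> < \<delta> ?F"
        using \<delta>[of ?F] by (simp add: blinfun.diff_right field_simps flip: diff_divide_distrib)
      then show ?thesis by (metis abs_ge_zero less_imp_le power2_abs power_mono)
    qed
    have "q ?F (x - y) (x - y) \<le> (\<Sum>\<phi>\<in>?F. (\<delta> ?F)\<^sup>2)"
      unfolding q_def using close by (intro sum_mono) (simp add: power2_eq_square)
    also have "\<dots> = real (card ?F) * (\<epsilon> / (4 * real (card ?F + 1)))" using \<epsilon> unfolding \<delta>_def by simp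
    also have "\<dots> \<le> \<epsilon> / 4" using \<epsilon> by (simp add: field_simps)
    finally have 1: "q ?F (x - y) (x - y) \<le> \<epsilon> / 4" .
    have "form C (\<lambda>x y. b x y - q ?F x y)"
    proof (rule form_minus[OF b])
      show "bilinear (q ?F)"
        unfolding bilinear_def q_def
        by (auto intro!: linearI sum.cong
            simp: blinfun.add_right blinfun.scaleR_right algebra_simps sum.distrib sum_distrib_left)
      show "q ?F u v = q ?F v u" for u v unfolding q_def by (simp add: mult.commute)
      show "0 \<le> q ?F u u" for u unfolding q_def by (simp add: sum_nonneg)
      show "q ?F u u \<le> b u u" for u
        using \<Phi> F(1,2)[of x] unfolding bessel_def q_def by (simp flip: power2_eq_square)
    qed
    from form_diff_le[OF this, of x y] F(3)[of x] F(3)[of y] Fy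
    have "b (x - y) (x - y) - q ?F (x - y) (x - y) < \<epsilon> / 2" by simp
    with 1 sep[OF xy(1,2,4)] \<epsilon> show False by simp
  qed
  have "k ` E \<subseteq> (SIGMA G : {G. finite G \<and> G \<subseteq> \<Phi>}. PiE G (\<lambda>_. UNIV))"
    using F unfolding k_def by (auto simp: restrict_PiE_iff)
  moreover have "countable (SIGMA G : {G. finite G \<and> G \<subseteq> \<Phi>}. PiE G (\<lambda>_. UNIV :: int set))"
    by (intro countable_SIGMA countable_Collect_finite_subset cnt countable_PiE) auto
  ultimately have "countable (k ` E)" by (rule countable_subset)
  then show ?thesis using inj by (rule countable_image_inj_on)
qed

text \<open>
  A maximal Bessel family cannot be countable, by the two preceding lemmas.
\<close>

lemma annihilating_family_of_nonseparable_form: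
  fixes b :: "'a::real_normed_vector \<Rightarrow> 'a \<Rightarrow> real"
  assumes b: "form C b" and E: "\<not> countable E" and \<epsilon>: "\<epsilon> > 0"
    and sep: "\<And>x y. x \<in> E \<Longrightarrow> y \<in> E \<Longrightarrow> x \<noteq> y \<Longrightarrow> \<epsilon> \<le> b (x - y) (x - y)"
  shows "\<exists>\<Phi>::('a \<Rightarrow>\<^sub>L real) set. annihilates \<Phi> \<and> card_of \<Phi> \<le>o omega1_card"
proof -
  have "\<exists>M\<in>Collect (bessel b). \<forall>X\<in>Collect (bessel b). M \<subseteq> X \<longrightarrow> X = M"
  proof (rule subset_Zorn_nonempty)
    have "bessel b {}" using formD(3)[OF b] unfolding bessel_def by auto
    then show "Collect (bessel b) \<noteq> {}" by blast
  next
    fix \<C> assume C: "\<C> \<noteq> {}" "subset.chain (Collect (bessel b)) \<C>"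
    have in_C: "bessel b \<Phi>" if "\<Phi> \<in> \<C>" for \<Phi> using C(2) that unfolding subset.chain_def by blast
    have "(\<Sum>\<phi>\<in>F. (blinfun_apply \<phi> x)\<^sup>2) \<le> b x x" if F: "finite F" "F \<subseteq> \<Union>\<C>" for F x
    proof -
      obtain \<Phi> where "\<Phi> \<in> \<C>" "F \<subseteq> \<Phi>"
        using finite_subset_Union_chain[OF F C(1) C(2)] by metis
      then show ?thesis using in_C F(1) unfolding bessel_def by blast
    qed
    moreover have "0 \<notin> \<Union>\<C>" using in_C unfolding bessel_def by blast
    ultimately show "\<Union>\<C> \<in> Collect (bessel b)" unfolding bessel_def by blast
  qed
  then obtain M where M: "bessel b M" and max: "\<And>\<Psi>. bessel b \<Psi> \<Longrightarrow> M \<subseteq> \<Psi> \<Longrightarrow> \<Psi> = M"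
    by auto
  have "\<not> countable M"
  proof
    assume cnt: "countable M"
    have "countable E"
      by (rule countable_separated_if_parseval[OF b M cnt maximal_bessel_parseval[OF b M cnt max] \<epsilon> sep])
    then show False using E by blast
  qed
  then show ?thesis
  proof (rule annihilating_cocountable_family[of M "\<lambda>\<phi>. \<phi>"])
    show "\<phi> \<noteq> 0" if "\<phi> \<in> M" for \<phi> using M that unfolding bessel_def by blast
    show "countable {\<phi> \<in> M. blinfun_apply \<phi> x \<noteq> 0}" for x by (rule bessel_countable_support[OF M])
  qed
qed

section \<open>Fundamental biorthogonal systems\<close>

text \<open>
  The combinations of \<open>M\<close> with rational coefficients form a countable set whose closure is a
  subspace.
\<close>

lemma separable_of_countable_spanning:
  assumes cnt: "countable M" and dense: "closure (span M) = (UNIV::'a::real_normed_vector set)"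
  shows "separable TYPE('a)"
proof -
  define s where "s l = sum_list (map (\<lambda>(q::rat, m::'a). (of_rat q :: real) *\<^sub>R m) l)" for l
  define D where "D = s ` lists (UNIV \<times> M)"
  have s_append: "s (k @ l) = s k + s l" for k l unfolding s_def by simp
  have D_add: "x + y \<in> D" if xy: "x \<in> D" "y \<in> D" for x y
  proof -
    obtain k l where "k \<in> lists (UNIV \<times> M)" "l \<in> lists (UNIV \<times> M)" "x = s k" "y = s l"
      using xy unfolding D_def by blast
    then show ?thesis unfolding D_def by (intro image_eqI[of _ _ "k @ l"]) (simp_all add: s_append)
  qed
  have D_scale: "(of_rat q :: real) *\<^sub>R x \<in> D" if x: "x \<in> D" for q x
  proof -
    obtain l where l: "l \<in> lists (UNIV \<times> M)" "x = s l" using x unfolding D_def by blast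
    have "(of_rat q :: real) *\<^sub>R s k = s (map (\<lambda>(r, m). (q * r, m)) k)" for k
      unfolding s_def by (induction k) (auto simp: scaleR_add_right of_rat_mult)
    moreover have "map (\<lambda>(r, m). (q * r, m)) l \<in> lists (UNIV \<times> M)"
      using l(1) by auto
    ultimately show ?thesis using l(2) unfolding D_def by simp
  qed
  have "subspace (closure D)"
    unfolding subspace_def
  proof (intro conjI ballI allI)
    have "s [] \<in> D" unfolding D_def by (rule imageI) simp
    then have "0 \<in> D" unfolding s_def by simp
    then show "0 \<in> closure D" using closure_subset by blast
  next
    fix x y assume "x \<in> closure D" "y \<in> closure D"
    then obtain f g where "\<And>n. f n \<in> D" "f \<longlonglongrightarrow> x" "\<And>n. g n \<in> D" "g \<longlonglongrightarrow> y"
      unfolding closure_sequential by blast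
    then show "x + y \<in> closure D"
      unfolding closure_sequential
      by (intro exI[of _ "\<lambda>n. f n + g n"]) (auto intro: D_add tendsto_add)
  next
    fix c :: real and x assume "x \<in> closure D"
    then obtain f where f: "\<And>n. f n \<in> D" "f \<longlonglongrightarrow> x" unfolding closure_sequential by blast
    have "c \<in> closure \<rat>" by (simp add: Rats_closure_real)
    then obtain q where q: "\<And>n. q n \<in> \<rat>" "q \<longlonglongrightarrow> c" unfolding closure_sequential by blast
    have "q n *\<^sub>R f n \<in> D" for n using q(1)[of n] f(1)[of n] D_scale by (auto elim!: Rats_cases)
    then show "c *\<^sub>R x \<in> closure D"
      unfolding closure_sequential using tendsto_scaleR[OF q(2) f(2)]
      by (intro exI[of _ "\<lambda>n. q n *\<^sub>R f n"]) auto
  qed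
  moreover have "M \<subseteq> closure D"
  proof
    fix m assume "m \<in> M"
    then have "s [(1, m)] \<in> D" unfolding D_def by (intro imageI) simp
    then show "m \<in> closure D" using closure_subset[of D] unfolding s_def by auto
  qed
  ultimately have "span M \<subseteq> closure D" by (simp add: span_minimal)
  then have "closure (span M) \<subseteq> closure D" by (rule closure_minimal) simp
  then have "closure D = UNIV" using dense by auto
  moreover have "countable D" unfolding D_def using cnt by (intro countable_image countable_lists) simp
  ultimately show ?thesis unfolding separable_def by blast
qed

text \<open>
  On the span of the system only finitely many coordinate functionals are nonzero at a vector. A limit
  of a sequence from the span is annihilated by all coordinate functionals that annihilate the whole
  sequence, so only countably many are nonzero at it. The index set is uncountable because the
  space is not separable.
\<close>

lemma fundamental_biorthogonal_annihilates:
  fixes x :: "'i \<Rightarrow> 'a::real_normed_vector"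
  assumes nonsep: "\<not> separable TYPE('a)" and fb: "fundamental_biorthogonal_system I x x'"
  shows "\<exists>\<Phi>::('a \<Rightarrow>\<^sub>L real) set. annihilates \<Phi> \<and> card_of \<Phi> \<le>o omega1_card"
proof (rule annihilating_cocountable_family[of I x'])
  have bi: "\<And>i j. i \<in> I \<Longrightarrow> j \<in> I \<Longrightarrow> blinfun_apply (x' i) (x j) = (if i = j then 1 else 0)"
    and dense: "closure (span (x ` I)) = UNIV"
    using fb unfolding fundamental_biorthogonal_system_def biorthogonal_system_def by auto
  show "\<not> countable I"
    using nonsep separable_of_countable_spanning[OF _ dense] by blast
  show "x' i \<noteq> 0" if "i \<in> I" for i using bi[OF that that] by auto
  show "countable {i \<in> I. blinfun_apply (x' i) z \<noteq> 0}" for z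
  proof -
    have fin: "finite {i \<in> I. blinfun_apply (x' i) w \<noteq> 0}" if "w \<in> span (x ` I)" for w
      using that
    proof (induction rule: span_induct_alt)
      case base
      show ?case by simp
    next
      case (step c y w)
      then obtain j where j: "j \<in> I" "y = x j" by blast
      have "{i \<in> I. blinfun_apply (x' i) (c *\<^sub>R y + w) \<noteq> 0} \<subseteq>
          insert j {i \<in> I. blinfun_apply (x' i) w \<noteq> 0}"
        using j by (auto simp: blinfun.add_right blinfun.scaleR_right bi)
      then show ?case using step by (meson finite_insert finite_subset)
    qed
    have "z \<in> closure (span (x ` I))" using dense by simp
    then obtain w where w: "\<And>n. w n \<in> span (x ` I)" "w \<longlonglongrightarrow> z"
      unfolding closure_sequential by blast
    have "{i \<in> I. blinfun_apply (x' i) z \<noteq> 0} \<subseteq> (\<Union>n. {i \<in> I. blinfun_apply (x' i) (w n) \<noteq> 0})"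
    proof (intro subsetI, rule ccontr)
      fix i assume i: "i \<in> {i \<in> I. blinfun_apply (x' i) z \<noteq> 0}"
        "i \<notin> (\<Union>n. {i \<in> I. blinfun_apply (x' i) (w n) \<noteq> 0})"
      then have "(\<lambda>n. blinfun_apply (x' i) (w n)) = (\<lambda>n. 0)" by auto
      moreover have "(\<lambda>n. blinfun_apply (x' i) (w n)) \<longlonglongrightarrow> blinfun_apply (x' i) z"
        using w(2) by (intro tendsto_intros)
      ultimately have "(\<lambda>n. 0) \<longlonglongrightarrow> blinfun_apply (x' i) z" by simp
      then show False using i(1) by (simp add: LIMSEQ_const_iff)
    qed
    then show ?thesis
      by (rule countable_subset) (rule countable_UN, simp, rule countable_finite, rule fin, rule w(1))
  qed
qed

section \<open>Continuous functions on scattered compact spaces\<close>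

lemma compact_t2_Urysohn:
  fixes S T :: "'k::t2_space set"
  assumes K: "compact (UNIV::'k set)" and ST: "closed S" "closed T" "S \<inter> T = {}"
  obtains g :: "'k \<Rightarrow> real" where "continuous_on UNIV g" "g ` S \<subseteq> {0}" "g ` T \<subseteq> {1}"
proof -
  have "Hausdorff_space (euclidean :: 'k topology)"
    unfolding Hausdorff_space_def using hausdorff by (fastforce simp: disjnt_def)
  moreover have "compact_space (euclidean :: 'k topology)"
    using K by (simp add: compact_space_def)
  ultimately have "normal_space (euclidean :: 'k topology)"
    by (simp add: compact_Hausdorff_or_regular_imp_normal_space)
  then obtain g where "continuous_map (euclidean :: 'k topology) euclideanreal g"
    "g ` S \<subseteq> {0}" "g ` T \<subseteq> {1}"
    using Urysohn_lemma_alt[of "euclidean :: 'k topology" S T 0 1] ST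
    by (metis closed_closedin disjnt_def)
  then show thesis using that by simp
qed

text \<open>
  Call a point good if \<open>f\<close> has countable range on some neighbourhood of it. If bad points
  existed, one of them, \<open>t\<close>, would be isolated among them. Near \<open>t\<close>, the points
  with \<open>\<bar>f s - f t\<bar> \<ge> 1 / (n + 1)\<close> lie in a compact set of good points, so
  \<open>f\<close> takes countably many values there; the union over \<open>n\<close>, together with the value
  \<open>f t\<close>, makes \<open>t\<close> good. So all points are good, and compactness concludes.
\<close>

lemma scattered_compact_countable_range:
  fixes f :: "'k::t2_space \<Rightarrow> real"
  assumes K: "compact (UNIV::'k set)" and scat: "scattered (UNIV::'k set)"
    and f: "continuous_on UNIV f"
  shows "countable (range f)"
proof -
  define G where "G = \<Union>{V. open V \<and> countable (f ` V)}"
  have compact_G: "countable (f ` C)" if C: "compact C" "C \<subseteq> G" for C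
  proof -
    have op: "\<And>V. V \<in> {V. open V \<and> countable (f ` V)} \<Longrightarrow> open V" by simp
    obtain \<V> where V: "\<V> \<subseteq> {V. open V \<and> countable (f ` V)}" "finite \<V>" "C \<subseteq> \<Union>\<V>"
      using compactE[OF C[unfolded G_def] op] .
    have "f ` C \<subseteq> (\<Union>V\<in>\<V>. f ` V)" using V(3) by blast
    moreover have "countable (\<Union>V\<in>\<V>. f ` V)"
      using V(1) by (intro countable_UN countable_finite[OF V(2)]) auto
    ultimately show ?thesis by (rule countable_subset)
  qed
  have "- G = {}"
  proof (rule ccontr)
    assume "- G \<noteq> {}"
    then obtain t where "t isolated_in (- G)" using scat unfolding scattered_def by blast
    then obtain V where V: "t \<notin> G" "open V" "V \<inter> - G = {t}" unfolding isolated_in_def by blast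
    have "closed {t}" "closed (- V)" "{t} \<inter> - V = {}" using V by auto
    then obtain g :: "'k \<Rightarrow> real" where g: "continuous_on UNIV g" "g ` {t} \<subseteq> {0}" "g ` (- V) \<subseteq> {1}"
      using compact_t2_Urysohn[OF K] by metis
    \<comment> \<open>The closed set \<open>{s. g s \<le> 1 / 2}\<close> is a neighbourhood of \<open>t\<close> inside \<open>V\<close>.\<close>
    define C where "C n = {s. g s \<le> 1 / 2} \<inter> {s. 1 / (real n + 1) \<le> \<bar>f s - f t\<bar>}" for n
    have "countable (f ` C n)" for n
    proof (rule compact_G)
      have "closed (C n)" unfolding C_def
        by (intro closed_Int closed_Collect_le continuous_intros f g(1))
      then show "compact (C n)" using compact_Int_closed[OF K] by simp
      show "C n \<subseteq> G"
      proof
        fix s assume s: "s \<in> C n"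
        have "s \<noteq> t" using s unfolding C_def by auto
        moreover have "s \<in> V" using s g(3) unfolding C_def by (cases "s \<in> V") auto
        ultimately show "s \<in> G" using V(3) by blast
      qed
    qed
    then have "countable (insert (f t) (\<Union>n. f ` C n))" by (intro countable_insert countable_UN) auto
    moreover have "f ` {s. g s < 1 / 2} \<subseteq> insert (f t) (\<Union>n. f ` C n)"
    proof clarify
      fix s assume s: "g s < 1 / 2" "f s \<notin> (\<Union>n. f ` C n)"
      show "f s = f t"
      proof (rule ccontr)
        assume "f s \<noteq> f t"
        then obtain n where "inverse (real (Suc n)) < \<bar>f s - f t\<bar>"
          using reals_Archimedean[of "\<bar>f s - f t\<bar>"] by auto
        then have "s \<in> C n" using s(1) unfolding C_def by (simp add: inverse_eq_divide add.commute)
        then show False using s(2) by blast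
      qed
    qed
    ultimately have "countable (f ` {s. g s < 1 / 2})" by (rule countable_subset[rotated])
    moreover have "open {s. g s < 1 / 2}" by (intro open_Collect_less continuous_intros g(1))
    moreover have "t \<in> {s. g s < 1 / 2}" using g(2) by simp
    ultimately have "t \<in> G" unfolding G_def by blast
    then show False using V(1) by blast
  qed
  then show ?thesis using compact_G[OF K] by blast
qed

text \<open>
  A countable compact Hausdorff space has a countable base \<open>B\<close>: finitely many of the sets that
  separate \<open>s\<close> from the other points already isolate it from a closed set not containing it. A
  function is then approximated through finitely many pairs of a basic open set and a rational value;
  picking one function for each finite set of such constraints that can be met gives a countable dense set.
\<close>

lemma countable_compact_separable_bcontfun:
  assumes K: "compact (UNIV::'k::t2_space set)" and cnt: "countable (UNIV::'k set)"
  shows "separable TYPE('k \<Rightarrow>\<^sub>C real)"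
proof -
  have "\<forall>s t::'k. \<exists>U V. s \<noteq> t \<longrightarrow> open U \<and> open V \<and> s \<in> U \<and> t \<in> V \<and> U \<inter> V = {}"
    using hausdorff by metis
  then obtain U V where UV: "\<And>s t::'k. s \<noteq> t \<Longrightarrow>
      open (U s t) \<and> open (V s t) \<and> s \<in> U s t \<and> t \<in> V s t \<and> U s t \<inter> V s t = {}"
    by metis
  define B where "B = (\<lambda>(s, F). \<Inter>t\<in>F. U s t) ` (UNIV \<times> {F. finite F \<and> F \<subseteq> UNIV})"
  have cntB: "countable B"
    unfolding B_def using cnt by (intro countable_image countable_SIGMA countable_Collect_finite_subset)
  have base: "\<exists>N\<in>B. open N \<and> s \<in> N \<and> N \<subseteq> W" if W: "open W" "s \<in> W" for s W
  proof -
    have "compact (- W)" using compact_Int_closed[OF K, of "- W"] W(1) by (simp add: closed_Compl)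
    moreover have "open (V s t)" if "t \<in> - W" for t using UV[of s t] W(2) that by blast
    moreover have "- W \<subseteq> (\<Union>t\<in>- W. V s t)"
    proof
      fix t assume t: "t \<in> - W"
      then have "s \<noteq> t" using W(2) by blast
      then show "t \<in> (\<Union>t\<in>- W. V s t)" using UV[of s t] t by blast
    qed
    ultimately obtain F where F: "F \<subseteq> - W" "finite F" "- W \<subseteq> (\<Union>t\<in>F. V s t)"
      by (rule compactE_image)
    have st: "s \<noteq> t" if "t \<in> F" for t using that F(1) W(2) by blast
    have "(\<Inter>t\<in>F. U s t) \<in> B" unfolding B_def using F(2) by (intro image_eqI[of _ _ "(s, F)"]) auto
    moreover have "open (\<Inter>t\<in>F. U s t)" using F(2) UV[OF st] by (intro open_INT) auto
    moreover have "s \<in> (\<Inter>t\<in>F. U s t)"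
    proof
      show "s \<in> U s t" if "t \<in> F" for t using UV[OF st[OF that]] by blast
    qed
    moreover have "(\<Inter>t\<in>F. U s t) \<subseteq> W"
    proof
      fix y assume y: "y \<in> (\<Inter>t\<in>F. U s t)"
      show "y \<in> W"
      proof (rule ccontr)
        assume "y \<notin> W"
        then obtain t where "t \<in> F" "y \<in> V s t" using F(3) by blast
        then show False using y UV[OF st[of t]] by blast
      qed
    qed
    ultimately show ?thesis by blast
  qed
  define P where "P l n g \<longleftrightarrow> (\<forall>(N, q)\<in>l. \<forall>s\<in>N. \<bar>apply_bcontfun g s - of_rat q\<bar> \<le> 1 / (real n + 1))"
    for l :: "('k set \<times> rat) set" and n :: nat and g :: "'k \<Rightarrow>\<^sub>C real"
  define pick where "pick = (\<lambda>(l, n). SOME g. P l n g)"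
  define D where "D = pick ` ({l. finite l \<and> l \<subseteq> B \<times> UNIV} \<times> UNIV)"
  have "countable D"
    unfolding D_def using cntB
    by (intro countable_image countable_SIGMA countable_Collect_finite_subset) auto
  moreover have "f \<in> closure D" for f
    unfolding closure_approachable
  proof (intro allI impI)
    fix e :: real assume "e > 0"
    then obtain n where "inverse (real (Suc n)) < e / 2" using reals_Archimedean[of "e / 2"] by auto
    then have n: "2 * (1 / (real n + 1)) < e" by (simp add: inverse_eq_divide add.commute)
    let ?e = "1 / (real n + 1)"
    have "\<exists>N q. N \<in> B \<and> open N \<and> s \<in> N \<and> (\<forall>y\<in>N. \<bar>apply_bcontfun f y - of_rat q\<bar> \<le> ?e)" for s
    proof -
      have "apply_bcontfun f s < apply_bcontfun f s + ?e" by simp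
      then obtain q where q: "apply_bcontfun f s < of_rat q" "of_rat q < apply_bcontfun f s + ?e"
        using of_rat_dense by blast
      let ?W = "{y. \<bar>apply_bcontfun f y - of_rat q\<bar> < ?e}"
      have "open ?W" by (intro open_Collect_less continuous_intros) auto
      moreover have "s \<in> ?W" using q by simp
      ultimately obtain N where "N \<in> B" "open N" "s \<in> N" "N \<subseteq> ?W" using base by blast
      then show ?thesis by (intro exI[of _ N] exI[of _ q]) force
    qed
    then obtain Ob q where Oq: "\<And>s. Ob s \<in> B \<and> open (Ob s) \<and> s \<in> Ob s \<and>
        (\<forall>y\<in>Ob s. \<bar>apply_bcontfun f y - of_rat (q s)\<bar> \<le> ?e)"
      by metis
    have "\<And>s. s \<in> UNIV \<Longrightarrow> open (Ob s)" "UNIV \<subseteq> (\<Union>s\<in>UNIV. Ob s)" using Oq by auto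
    then obtain S where S: "S \<subseteq> UNIV" "finite S" "UNIV \<subseteq> (\<Union>s\<in>S. Ob s)"
      using compactE_image[OF K] by metis
    define l where "l = (\<lambda>s. (Ob s, q s)) ` S"
    have "P l n f" unfolding P_def l_def using Oq by auto
    then have P: "P l n (pick (l, n))" unfolding pick_def by (simp add: someI)
    have "pick (l, n) \<in> D" unfolding D_def using S(2) Oq by (intro imageI) (auto simp: l_def)
    moreover have "dist (pick (l, n)) f \<le> 2 * ?e"
    proof (rule dist_bound)
      fix y
      obtain s where s: "s \<in> S" "y \<in> Ob s" using S(3) by blast
      have "\<bar>apply_bcontfun (pick (l, n)) y - of_rat (q s)\<bar> \<le> ?e"
        using P s unfolding P_def l_def by fastforce
      moreover have "\<bar>apply_bcontfun f y - of_rat (q s)\<bar> \<le> ?e" using Oq s(2) by blast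
      ultimately show "dist (apply_bcontfun (pick (l, n)) y) (apply_bcontfun f y) \<le> 2 * ?e"
        unfolding dist_real_def by linarith
    qed
    ultimately show "\<exists>y\<in>D. dist y f < e" using n by (meson le_less_trans)
  qed
  ultimately show ?thesis unfolding separable_def by blast
qed

text \<open>
  Evaluations at distinct points are distinct by Urysohn's lemma. Since the functions in question have
  countable range, none of them is injective on an uncountable set of points.
\<close>

lemma scattered_bcontfun_annihilates:
  fixes T :: "'a::real_normed_vector \<Rightarrow> ('k::t2_space \<Rightarrow>\<^sub>C real)"
  assumes nonsep: "\<not> separable TYPE('a)" and K: "compact (UNIV::'k set)"
    and scat: "scattered (UNIV::'k set)" and T: "linear_isometry_onto T"
  shows "\<exists>\<Phi>::('a \<Rightarrow>\<^sub>L real) set. annihilates \<Phi> \<and> card_of \<Phi> \<le>o omega1_card"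
proof -
  have lin: "linear T" and surj: "surj T" and iso: "\<And>x. norm (T x) = norm x"
    using T unfolding linear_isometry_onto_def by auto
  have "\<not> countable (UNIV::'k set)"
  proof
    assume "countable (UNIV::'k set)"
    then obtain D :: "('k \<Rightarrow>\<^sub>C real) set" where D: "countable D" "closure D = UNIV"
      using countable_compact_separable_bcontfun[OF K] unfolding separable_def by blast
    have "x \<in> closure (inv T ` D)" for x
      unfolding closure_approachable
    proof (intro allI impI)
      fix e :: real assume "e > 0"
      moreover have "T x \<in> closure D" using D(2) by simp
      ultimately obtain d where d: "d \<in> D" "dist d (T x) < e" unfolding closure_approachable by blast
      have "dist (inv T d) x = norm (T (inv T d - x))" by (simp add: iso dist_norm)
      also have "\<dots> = dist d (T x)"
        by (simp add: linear_diff[OF lin] surj_f_inv_f[OF surj] dist_norm)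
      finally show "\<exists>y\<in>inv T ` D. dist y x < e" using d by (intro bexI[of _ "inv T d"]) simp_all
    qed
    then have "separable TYPE('a)" unfolding separable_def using D(1)
      by (intro exI[of _ "inv T ` D"]) auto
    then show False using nonsep by blast
  qed
  then obtain S :: "'k set" where S: "card_of S =o omega1_card" "\<not> countable S"
    using uncountable_obtains_omega1_subset by metis
  define \<phi> where "\<phi> = (\<lambda>(s, t). Blinfun (\<lambda>x. apply_bcontfun (T x) s - apply_bcontfun (T x) t))"
  have app: "blinfun_apply (\<phi> (s, t)) x = apply_bcontfun (T x) s - apply_bcontfun (T x) t" for s t x
  proof -
    have "bounded_linear (\<lambda>x. apply_bcontfun (T x) s - apply_bcontfun (T x) t)"
    proof (rule bounded_linear_intro[where K = 2])
      show "norm (apply_bcontfun (T x) s - apply_bcontfun (T x) t) \<le> norm x * 2" for x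
        using norm_bounded[of "T x" s] norm_bounded[of "T x" t] iso[of x] by simp
    qed (simp_all add: linear_add[OF lin] linear_scale[OF lin] algebra_simps)
    then show ?thesis unfolding \<phi>_def by (simp add: bounded_linear_Blinfun_apply)
  qed
  define \<Phi> where "\<Phi> = \<phi> ` {(s, t). s \<in> S \<and> t \<in> S \<and> s \<noteq> t}"
  have "0 \<notin> \<Phi>"
  proof
    assume "0 \<in> \<Phi>"
    then obtain s t where st: "s \<noteq> t" "\<phi> (s, t) = 0" unfolding \<Phi>_def by auto
    obtain g :: "'k \<Rightarrow> real" where g: "continuous_on UNIV g" "g ` {s} \<subseteq> {0}" "g ` {t} \<subseteq> {1}"
      using compact_t2_Urysohn[OF K, of "{s}" "{t}"] st(1) by auto
    have "g \<in> bcontfun"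
      using g(1) compact_imp_bounded[OF compact_continuous_image[OF g(1) K]]
      unfolding bcontfun_def by simp
    then obtain x where "apply_bcontfun (T x) = g"
      using surj by (metis Bcontfun_inverse surjD)
    then have "blinfun_apply (\<phi> (s, t)) x = - 1" using app g(2,3) by simp
    then show False using st(2) by simp
  qed
  moreover have "\<exists>\<psi>\<in>\<Phi>. blinfun_apply \<psi> x = 0" for x
  proof -
    have "countable (range (apply_bcontfun (T x)))"
      by (rule scattered_compact_countable_range[OF K scat]) simp
    then have "countable (apply_bcontfun (T x) ` S)" by (rule countable_subset[rotated]) blast
    then have "\<not> inj_on (apply_bcontfun (T x)) S" using S(2) countable_image_inj_on by blast
    then obtain s t where "s \<in> S" "t \<in> S" "s \<noteq> t" "apply_bcontfun (T x) s = apply_bcontfun (T x) t"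
      unfolding inj_on_def by blast
    then show ?thesis unfolding \<Phi>_def by (intro bexI[of _ "\<phi> (s, t)"]) (auto simp: app)
  qed
  moreover have "card_of \<Phi> \<le>o omega1_card"
  proof -
    have "infinite S" using S(2) countable_finite by blast
    then have "card_of (S \<times> S) =o omega1_card"
      by (rule ordIso_transitive[OF card_of_Times_same_infinite S(1)])
    moreover have "card_of {(s, t). s \<in> S \<and> t \<in> S \<and> s \<noteq> t} \<le>o card_of (S \<times> S)"
      by (rule card_of_mono1) auto
    ultimately have "card_of {(s, t). s \<in> S \<and> t \<in> S \<and> s \<noteq> t} \<le>o omega1_card"
      by (rule ordLeq_ordIso_trans[rotated])
    then show ?thesis unfolding \<Phi>_def by (rule ordLeq_transitive[OF card_of_image])
  qed
  ultimately show ?thesis unfolding annihilates_def by (intro exI[of _ \<Phi>] conjI allI)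
qed

section \<open>Copies of \<open>\<ell>\<^sub>1\<close> over an uncountable set\<close>

text \<open>
  The lower \<open>\<ell>\<^sub>1\<close> estimate says exactly that the prescribed values are dominated by
  \<open>norm x / c\<close> on the span of the vectors \<open>y i\<close>.
\<close>

lemma functional_with_signs:
  fixes y :: "'j \<Rightarrow> 'a::real_normed_vector" and \<sigma> :: "'j \<Rightarrow> real"
  assumes c: "c > 0" and F: "finite F"
    and lower: "\<And>t. c * (\<Sum>i\<in>F. \<bar>t i\<bar>) \<le> norm (\<Sum>i\<in>F. t i *\<^sub>R y i)"
    and \<sigma>: "\<And>i. \<bar>\<sigma> i\<bar> \<le> 1"
  shows "\<exists>\<phi>::'a \<Rightarrow>\<^sub>L real. (\<forall>x. \<bar>blinfun_apply \<phi> x\<bar> \<le> norm x / c) \<and> (\<forall>i\<in>F. blinfun_apply \<phi> (y i) = \<sigma> i)"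
proof -
  define g where "g t = ((\<Sum>i\<in>F. t i *\<^sub>R y i), (\<Sum>i\<in>F. t i * \<sigma> i))" for t
  have "subspace (range g)"
    unfolding subspace_def
  proof (intro conjI ballI allI)
    have "0 = g (\<lambda>_. 0)" unfolding g_def by (simp add: zero_prod_def)
    then show "0 \<in> range g" by blast
  next
    fix u v assume "u \<in> range g" "v \<in> range g"
    then obtain s t where "u = g s" "v = g t" by blast
    then have "u + v = g (\<lambda>i. s i + t i)"
      unfolding g_def by (simp add: scaleR_add_left sum.distrib distrib_right)
    then show "u + v \<in> range g" by blast
  next
    fix k u assume "u \<in> range g"
    then obtain t where "u = g t" by blast
    then have "k *\<^sub>R u = g (\<lambda>i. k * t i)"
      unfolding g_def by (simp add: scaleR_sum_right sum_distrib_left mult.assoc)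
    then show "k *\<^sub>R u \<in> range g" by blast
  qed
  moreover have "r \<le> norm x / c" if xr: "(x, r) \<in> range g" for x r
  proof -
    obtain t where "(x, r) = g t" using xr by blast
    then have t: "x = (\<Sum>i\<in>F. t i *\<^sub>R y i)" "r = (\<Sum>i\<in>F. t i * \<sigma> i)"
      unfolding g_def by simp_all
    have "r \<le> (\<Sum>i\<in>F. \<bar>t i\<bar>)"
      unfolding t(2)
    proof (rule sum_mono)
      fix i
      have "t i * \<sigma> i \<le> \<bar>t i\<bar> * \<bar>\<sigma> i\<bar>" by (metis abs_ge_self abs_mult)
      also have "\<dots> \<le> \<bar>t i\<bar> * 1" using \<sigma> by (intro mult_left_mono) auto
      finally show "t i * \<sigma> i \<le> \<bar>t i\<bar>" by simp
    qed
    also have "\<dots> \<le> norm x / c" using lower[of t] c t(1) by (simp add: field_simps)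
    finally show ?thesis .
  qed
  moreover have "norm (x + z) / c \<le> norm x / c + norm z / c" for x z :: 'a
    using c norm_triangle_ineq[of x z] by (simp add: divide_right_mono flip: add_divide_distrib)
  moreover have "norm (k *\<^sub>R x) / c = \<bar>k\<bar> * (norm x / c)" for k and x :: 'a by simp
  moreover have "norm x / c \<le> 1 / c * norm x" for x :: 'a by simp
  ultimately obtain \<phi> :: "'a \<Rightarrow>\<^sub>L real" where \<phi>: "\<And>x. \<bar>blinfun_apply \<phi> x\<bar> \<le> norm x / c"
    "\<And>x r. (x, r) \<in> range g \<Longrightarrow> blinfun_apply \<phi> x = r"
    using dominated_functional[of "\<lambda>x. norm x / c" "1 / c" "range g"] by metis
  have "blinfun_apply \<phi> (y i) = \<sigma> i" if "i \<in> F" for i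
  proof (rule \<phi>(2))
    have "g (\<lambda>j. if j = i then 1 else 0) = (y i, \<sigma> i)"
      using that F unfolding g_def by (simp add: if_distrib[of "\<lambda>c. c *\<^sub>R _"] if_distrib[of "\<lambda>c. c * _"] cong: if_cong)
    then show "(y i, \<sigma> i) \<in> range g" by (metis rangeI)
  qed
  then show ?thesis using \<phi>(1) by blast
qed

text \<open>
  The coordinates of a random sign vector are orthonormal; a sign vector is encoded by the set of its
  positive coordinates.
\<close>

lemma sign_average_orthonormal:
  fixes F :: "'j set"
  assumes F: "finite F" and ij: "i \<in> F" "j \<in> F"
  defines "\<sigma> \<equiv> \<lambda>S k. if k \<in> S then 1 else - 1 :: real"
  shows "(\<Sum>S\<in>Pow F. \<sigma> S i * \<sigma> S j) / 2 ^ card F = (if i = j then 1 else 0)"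
proof (cases "i = j")
  case True
  have "\<sigma> S i * \<sigma> S i = 1" for S unfolding \<sigma>_def by simp
  then show ?thesis using True F by (simp add: card_Pow)
next
  case False
  \<comment> \<open>Changing the sign of coordinate \<open>i\<close> changes the sign of the product.\<close>
  define flip where "flip S = (if i \<in> S then S - {i} else insert i S)" for S
  have "(\<Sum>S\<in>Pow F. \<sigma> S i * \<sigma> S j) = (\<Sum>S\<in>Pow F. - (\<sigma> S i * \<sigma> S j))"
    using ij False
    by (intro sum.reindex_bij_witness[of _ flip flip]) (auto simp: flip_def \<sigma>_def split: if_splits)
  then show ?thesis using False by (simp add: sum_negf)
qed

text \<open>
  Averaging the rank-one forms of functionals that take prescribed signs on the \<open>y i\<close>, over all
  choices of signs, makes the \<open>y i\<close> orthonormal while the bound \<open>1 / c\<^sup>2\<close> does not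
  depend on the number of vectors.
\<close>

lemma sign_averaged_form:
  fixes y :: "'j \<Rightarrow> 'a::real_normed_vector"
  assumes c: "c > 0" and F: "finite F"
    and lower: "\<And>t. c * (\<Sum>i\<in>F. \<bar>t i\<bar>) \<le> norm (\<Sum>i\<in>F. t i *\<^sub>R y i)"
  shows "\<exists>b. form (1 / c\<^sup>2) b \<and> (\<forall>i\<in>F. \<forall>j\<in>F. b (y i) (y j) = (if i = j then 1 else 0))"
proof -
  define \<sigma> where "\<sigma> = (\<lambda>S (k::'j). if k \<in> S then 1 else - 1 :: real)"
  have "\<exists>\<phi>::'a \<Rightarrow>\<^sub>L real. (\<forall>x. \<bar>blinfun_apply \<phi> x\<bar> \<le> norm x / c) \<and>
      (\<forall>i\<in>F. blinfun_apply \<phi> (y i) = \<sigma> S i)" for S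
    by (rule functional_with_signs[OF c F lower]) (simp add: \<sigma>_def)
  then obtain \<phi> :: "'j set \<Rightarrow> 'a \<Rightarrow>\<^sub>L real" where \<phi>: "\<And>S x. \<bar>blinfun_apply (\<phi> S) x\<bar> \<le> norm x / c"
    "\<And>S i. i \<in> F \<Longrightarrow> blinfun_apply (\<phi> S) (y i) = \<sigma> S i"
    by metis
  define b where "b x z = (\<Sum>S\<in>Pow F. blinfun_apply (\<phi> S) x * blinfun_apply (\<phi> S) z) / 2 ^ card F" for x z
  have "form (1 / c\<^sup>2) b"
    unfolding form_def
  proof (intro conjI allI)
    show "bilinear b"
      unfolding bilinear_def b_def
      by (auto intro!: linearI sum.cong simp: blinfun.add_right blinfun.scaleR_right algebra_simps
          sum.distrib sum_distrib_left add_divide_distrib)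
    show "b x z = b z x" for x z unfolding b_def by (simp add: mult.commute)
    show "0 \<le> b x x" for x unfolding b_def by (simp add: sum_nonneg)
    show "b x x \<le> 1 / c\<^sup>2 * (norm x)\<^sup>2" for x
    proof -
      have "(\<Sum>S\<in>Pow F. blinfun_apply (\<phi> S) x * blinfun_apply (\<phi> S) x) \<le> (\<Sum>S\<in>Pow F. (norm x / c)\<^sup>2)"
      proof (rule sum_mono)
        fix S
        have "\<bar>blinfun_apply (\<phi> S) x\<bar>\<^sup>2 \<le> (norm x / c)\<^sup>2" by (rule power_mono[OF \<phi>(1)]) simp
        then show "blinfun_apply (\<phi> S) x * blinfun_apply (\<phi> S) x \<le> (norm x / c)\<^sup>2"
          by (simp add: power2_eq_square)
      qed
      also have "\<dots> = 2 ^ card F * (norm x / c)\<^sup>2" using F by (simp add: card_Pow)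
      finally show ?thesis unfolding b_def by (simp add: field_simps)
    qed
  qed
  moreover have "b (y i) (y j) = (if i = j then 1 else 0)" if "i \<in> F" "j \<in> F" for i j
    unfolding b_def \<phi>(2)[OF that(1)] \<phi>(2)[OF that(2)] unfolding \<sigma>_def
    by (rule sign_average_orthonormal[OF F that])
  ultimately show ?thesis by blast
qed

lemma orthonormal_form_on_l1_system:
  fixes y :: "'j \<Rightarrow> 'a::real_normed_vector"
  assumes c: "c > 0"
    and lower: "\<And>F t. finite F \<Longrightarrow> c * (\<Sum>i\<in>F. \<bar>t i\<bar>) \<le> norm (\<Sum>i\<in>F. t i *\<^sub>R y i)"
  obtains b where "form (1 / c\<^sup>2) b" "\<And>i j. b (y i) (y j) = (if i = j then 1 else 0)"
proof -
  have "\<forall>F. \<exists>b. finite F \<longrightarrow> form (1 / c\<^sup>2) b \<and>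
      (\<forall>i\<in>F. \<forall>j\<in>F. b (y i) (y j) = (if i = j then 1 else 0))"
    using sign_averaged_form[OF c _ lower] by metis
  then obtain B where B: "\<And>F. finite F \<Longrightarrow> form (1 / c\<^sup>2) (B F)"
    "\<And>F i j. finite F \<Longrightarrow> i \<in> F \<Longrightarrow> j \<in> F \<Longrightarrow> B F (y i) (y j) = (if i = j then 1 else 0)"
    by metis
  have ev: "\<forall>\<^sub>F F in finite_subsets_at_top UNIV. B F \<in> {b. form (1 / c\<^sup>2) b}"
    using B(1) by (intro eventually_finite_subsets_at_top_weakI) simp
  obtain b where b: "b \<in> {b. form (1 / c\<^sup>2) b}"
    "\<forall>T. closed T \<longrightarrow> (\<forall>\<^sub>F F in finite_subsets_at_top UNIV. B F \<in> T) \<longrightarrow> b \<in> T"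
    using compact_filter_cluster[OF compact_form finite_subsets_at_top_neq_bot ev] by (elim bexE)
  have "b \<in> {b. b (y i) (y j) = (if i = j then 1 else 0)}" for i j
  proof (rule b(2)[rule_format])
    show "closed {b::'a \<Rightarrow> 'a \<Rightarrow> real. b (y i) (y j) = (if i = j then 1 else 0)}"
      by (intro closed_Collect_eq continuous_eval2 continuous_on_const)
    show "\<forall>\<^sub>F F in finite_subsets_at_top UNIV. B F \<in> {b. b (y i) (y j) = (if i = j then 1 else 0)}"
      unfolding eventually_finite_subsets_at_top using B(2) by (intro exI[of _ "{i, j}"]) auto
  qed
  then show thesis using b(1) that by simp
qed

text \<open>
  The images of the unit vectors are orthonormal for a bounded form, hence uniformly separated.
\<close>

lemma annihilating_family_of_l1_embedding:
  fixes T :: "'i ell1 \<Rightarrow> 'a::real_normed_vector"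
  assumes unc: "\<not> countable (UNIV::'i set)" and T: "isomorphic_embedding T"
  shows "\<exists>\<Phi>::('a \<Rightarrow>\<^sub>L real) set. annihilates \<Phi> \<and> card_of \<Phi> \<le>o omega1_card"
proof -
  obtain c where lin: "bounded_linear T" and c: "c > 0" "\<And>x. c * norm x \<le> norm (T x)"
    using T unfolding isomorphic_embedding_def by blast
  interpret T: bounded_linear T by (rule lin)
  define e :: "'i \<Rightarrow> 'i ell1" where "e i = Abs_ell1 (\<lambda>j. if j = i then 1 else 0)" for i
  have Rep_e: "Rep_ell1 (e i) = (\<lambda>j. if j = i then 1 else 0)" for i
  proof -
    have "((\<lambda>j. \<bar>if j = i then 1 else 0 :: real\<bar>) has_sum 1) UNIV"
      by (rule has_sum_finite_neutralI[of "{i}"]) auto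
    then show ?thesis unfolding e_def by (simp add: Abs_ell1_inverse has_sum_imp_summable)
  qed
  have Rep_sum: "Rep_ell1 (\<Sum>i\<in>F. t i *\<^sub>R e i) = (\<lambda>j. if j \<in> F then t j else 0)" if "finite F" for F t
    using that
    by (induction F rule: finite_induct)
      (auto simp: zero_ell1.rep_eq plus_ell1.rep_eq scaleR_ell1.rep_eq Rep_e fun_eq_iff)
  have norm_sum: "norm (\<Sum>i\<in>F. t i *\<^sub>R e i) = (\<Sum>i\<in>F. \<bar>t i\<bar>)" if F: "finite F" for F t
  proof -
    have "((\<lambda>j. \<bar>if j \<in> F then t j else 0\<bar>) has_sum (\<Sum>i\<in>F. \<bar>t i\<bar>)) UNIV"
      using F by (intro has_sum_finite_neutralI[of F]) auto
    then show ?thesis by (simp add: norm_ell1.rep_eq Rep_sum[OF F] infsumI)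
  qed
  have "c * (\<Sum>i\<in>F. \<bar>t i\<bar>) \<le> norm (\<Sum>i\<in>F. t i *\<^sub>R T (e i))" if "finite F" for F t
    using c(2)[of "\<Sum>i\<in>F. t i *\<^sub>R e i"] by (simp add: norm_sum[OF that] T.sum T.scaleR)
  then obtain b where b: "form (1 / c\<^sup>2) b" "\<And>i j. b (T (e i)) (T (e j)) = (if i = j then 1 else 0)"
    using orthonormal_form_on_l1_system[OF c(1), of "\<lambda>i. T (e i)"] by metis
  have dist: "b (T (e i) - T (e j)) (T (e i) - T (e j)) = 2" if "i \<noteq> j" for i j
    using form_square_add[OF b(1), of "T (e i)" "- 1" "T (e j)"] that by (simp add: b(2))
  have "inj (\<lambda>i. T (e i))"
    by (rule injI) (metis b(2) zero_neq_one)
  then have "\<not> countable (range (\<lambda>i. T (e i)))" using unc countable_image_inj_on by blast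
  then show ?thesis
  proof (rule annihilating_family_of_nonseparable_form[OF b(1) _ zero_less_one])
    fix u v assume "u \<in> range (\<lambda>i. T (e i))" "v \<in> range (\<lambda>i. T (e i))" "u \<noteq> v"
    then obtain i j where "u = T (e i)" "v = T (e j)" "i \<noteq> j" by blast
    then show "1 \<le> b (u - v) (u - v)" by (simp add: dist)
  qed
qed

section \<open>Countable sets that are dense for all limit forms\<close>

text \<open>
  The sets of pairs \<open>(n, d)\<close> handle all scales at once: for each \<open>n\<close>, the vectors at
  level \<open>n\<close> have to be \<open>1 / (n + 1)\<close>-separated for some common form in
  \<open>\<B>\<close>. By compactness such sets are closed under unions of chains. For a maximal set
  \<open>M\<close>, each level is countable by hypothesis. A form that agrees with \<open>\<mu>\<close> on
  the occurring vectors separates \<open>M\<close> as well as \<open>\<mu>\<close> does, so by maximality no further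
  vector can be added at any level, which is density.
\<close>

lemma form_determining_set:
  fixes \<B> :: "('a::real_normed_vector \<Rightarrow> 'a \<Rightarrow> real) set"
  assumes closed: "closed \<B>" and ne: "\<B> \<noteq> {}" and form: "\<And>b. b \<in> \<B> \<Longrightarrow> form C b"
    and sep: "\<And>b E \<epsilon>. b \<in> \<B> \<Longrightarrow> \<epsilon> > 0 \<Longrightarrow>
      (\<And>x y. x \<in> E \<Longrightarrow> y \<in> E \<Longrightarrow> x \<noteq> y \<Longrightarrow> \<epsilon> \<le> b (x - y) (x - y)) \<Longrightarrow> countable E"
  obtains \<mu> D where "\<mu> \<in> \<B>" "countable D"
    "\<And>b x \<epsilon>. b \<in> \<B> \<Longrightarrow> (\<And>d d'. d \<in> D \<Longrightarrow> d' \<in> D \<Longrightarrow> b d d' = \<mu> d d') \<Longrightarrow> \<epsilon> > 0 \<Longrightarrow>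
      \<exists>d\<in>D. b (x - d) (x - d) < \<epsilon>"
proof -
  define separated where "separated S b \<longleftrightarrow>
      (\<forall>n d d'. (n, d) \<in> S \<longrightarrow> (n, d') \<in> S \<longrightarrow> d \<noteq> d' \<longrightarrow> 1 / (real n + 1) \<le> b (d - d') (d - d'))"
    for S :: "(nat \<times> 'a) set" and b :: "'a \<Rightarrow> 'a \<Rightarrow> real"
  have closed_sep: "closed {b. separated S b}" for S
    unfolding separated_def
    by (intro closed_Collect_all closed_Collect_imp closed_Collect_le continuous_eval2
        continuous_on_const open_Collect_const)
  have compact: "compact \<B>"
  proof -
    have "compact ({b. form C b} \<inter> \<B>)" by (rule compact_Int_closed[OF compact_form closed])
    also have "{b. form C b} \<inter> \<B> = \<B>" using form by blast
    finally show ?thesis .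
  qed
  define \<S> where "\<S> = {S. \<exists>b\<in>\<B>. separated S b}"
  have "\<exists>M\<in>\<S>. \<forall>X\<in>\<S>. M \<subseteq> X \<longrightarrow> X = M"
  proof (rule subset_Zorn_nonempty)
    have "{} \<in> \<S>" using ne unfolding \<S>_def separated_def by auto
    then show "\<S> \<noteq> {}" by blast
  next
    fix \<C> assume C: "\<C> \<noteq> {}" "subset.chain \<S> \<C>"
    have "\<B> \<inter> (\<Inter>S\<in>\<C>. {b. separated S b}) \<noteq> {}"
    proof (rule compact_imp_fip_image[OF compact closed_sep])
      fix \<F> assume F: "finite \<F>" "\<F> \<subseteq> \<C>"
      show "\<B> \<inter> (\<Inter>S\<in>\<F>. {b. separated S b}) \<noteq> {}"
      proof (cases "\<F> = {}")
        case True
        then show ?thesis using ne by simp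
      next
        case False
        have "subset.chain \<S> \<F>" using C(2) F(2) unfolding subset.chain_def by blast
        then have "\<Union>\<F> \<in> \<F>" using Union_in_chain[OF F(1) False] by blast
        then have "\<Union>\<F> \<in> \<S>" using F(2) C(2) unfolding subset.chain_def by blast
        then obtain b where "b \<in> \<B>" "separated (\<Union>\<F>) b" unfolding \<S>_def by blast
        moreover from this(2) have "separated S b" if "S \<in> \<F>" for S
          using that unfolding separated_def by blast
        ultimately show ?thesis by blast
      qed
    qed
    then obtain b where b: "b \<in> \<B>" "\<And>S. S \<in> \<C> \<Longrightarrow> separated S b" by blast
    have "separated (\<Union>\<C>) b"
      unfolding separated_def
    proof (intro allI impI)
      fix n d d' assume d: "(n, d) \<in> \<Union>\<C>" "(n, d') \<in> \<Union>\<C>" "d \<noteq> d'"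
      then obtain S where "S \<in> \<C>" "(n, d) \<in> S" "(n, d') \<in> S"
        using C(2) unfolding subset.chain_def by blast
      then show "1 / (real n + 1) \<le> b (d - d') (d - d')"
        using b(2)[of S] d(3) unfolding separated_def by blast
    qed
    then show "\<Union>\<C> \<in> \<S>" using b(1) unfolding \<S>_def by blast
  qed
  then obtain M where M: "M \<in> \<S>" and max: "\<And>X. X \<in> \<S> \<Longrightarrow> M \<subseteq> X \<Longrightarrow> X = M" by blast
  obtain \<mu> where \<mu>: "\<mu> \<in> \<B>" "separated M \<mu>" using M unfolding \<S>_def by blast
  define D where "D = snd ` M"
  have "countable {d. (n, d) \<in> M}" for n
    by (rule sep[OF \<mu>(1), of "1 / (real n + 1)"]) (use \<mu>(2) in \<open>auto simp: separated_def\<close>)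
  then have "countable (\<Union>n. {d. (n, d) \<in> M})" by (intro countable_UN) auto
  moreover have "D = (\<Union>n. {d. (n, d) \<in> M})" unfolding D_def by force
  ultimately have cntD: "countable D" by simp
  have dense: "\<exists>d\<in>D. b (x - d) (x - d) < \<epsilon>"
    if b: "b \<in> \<B>" and agree: "\<And>d d'. d \<in> D \<Longrightarrow> d' \<in> D \<Longrightarrow> b d d' = \<mu> d d'" and \<epsilon>: "\<epsilon> > 0"
    for b x \<epsilon>
  proof -
    obtain n where "inverse (real (Suc n)) < \<epsilon>" using reals_Archimedean[OF \<epsilon>] by blast
    then have n: "1 / (real n + 1) < \<epsilon>" by (simp add: inverse_eq_divide add.commute)
    have sepb: "separated M b"
      unfolding separated_def
    proof (intro allI impI)
      fix k d d' assume d: "(k, d) \<in> M" "(k, d') \<in> M" "d \<noteq> d'"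
      then have "d \<in> D" "d' \<in> D" unfolding D_def by force+
      then have "b (d - d') (d - d') = \<mu> (d - d') (d - d')"
        using agree form_square_diff[OF form[OF b]] form_square_diff[OF form[OF \<mu>(1)]] by simp
      then show "1 / (real k + 1) \<le> b (d - d') (d - d')"
        using \<mu>(2) d unfolding separated_def by simp
    qed
    show ?thesis
    proof (rule ccontr)
      assume "\<not> ?thesis"
      then have far: "1 / (real n + 1) \<le> b (x - d) (x - d)" if "(n, d) \<in> M" for d
        using that n unfolding D_def by force
      have far': "1 / (real n + 1) \<le> b (d - x) (d - x)" if "(n, d) \<in> M" for d
        using far[OF that] form_commute_diff[OF form[OF b], of x d] by simp
      have "separated (insert (n, x) M) b"
        using sepb far far' unfolding separated_def by auto
      then have "insert (n, x) M \<in> \<S>" using b unfolding \<S>_def by blast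
      then have "(n, x) \<in> M" using max by blast
      then have "1 / (real n + 1) \<le> b (x - x) (x - x)" by (rule far)
      moreover have "b 0 0 = 0" using form_scale[OF form[OF b], of 0 0] by simp
      ultimately show False by (simp add: field_simps)
    qed
  qed
  show thesis
  proof (rule that[of \<mu> D])
    fix b x \<epsilon>
    assume "b \<in> \<B>" "\<And>d d'. d \<in> D \<Longrightarrow> d' \<in> D \<Longrightarrow> b d d' = \<mu> d d'" "0 < (\<epsilon>::real)"
    then show "\<exists>d\<in>D. b (x - d) (x - d) < \<epsilon>" by (rule dense)
  qed (fact \<mu>(1), fact cntD)
qed

text \<open>
  The functional is prescribed to be \<open>0\<close> on \<open>D\<close> and \<open>sqrt \<delta>\<close> at \<open>h\<close>; the
  distance hypothesis says that this is dominated by the seminorm of \<open>\<rho>\<close>.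
\<close>

lemma form_residual_functional:
  fixes \<rho> :: "'a::real_normed_vector \<Rightarrow> 'a \<Rightarrow> real"
  assumes \<rho>: "form C \<rho>" and \<delta>: "\<delta> > 0" and far: "\<And>d. d \<in> span D \<Longrightarrow> \<delta> \<le> \<rho> (h - d) (h - d)"
  shows "\<exists>\<phi>::'a \<Rightarrow>\<^sub>L real. \<phi> \<noteq> 0 \<and> (\<forall>x. (blinfun_apply \<phi> x)\<^sup>2 \<le> \<rho> x x) \<and> (\<forall>d\<in>D. blinfun_apply \<phi> d = 0)"
proof -
  let ?s = "sqrt \<delta>"
  define g where "g = (\<lambda>(d, t). (d + t *\<^sub>R h, t * ?s))"
  have "linear g"
    unfolding g_def by (intro linearI) (auto simp: algebra_simps)
  then have sub: "subspace (g ` (span D \<times> UNIV))"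
    by (intro linear_subspace_image subspace_Times subspace_span subspace_UNIV)
  have dom: "r \<le> sqrt (\<rho> x x)" if xr: "(x, r) \<in> g ` (span D \<times> UNIV)" for x r
  proof -
    obtain d t where d: "d \<in> span D" "x = d + t *\<^sub>R h" "r = t * ?s"
      using xr unfolding g_def by auto
    show ?thesis
    proof (cases "t = 0")
      case True
      then show ?thesis using d(3) formD(3)[OF \<rho>, of x] by simp
    next
      case False
      have "(- (1 / t)) *\<^sub>R d \<in> span D" using d(1) by (rule span_scale)
      from far[OF this] have "t\<^sup>2 * \<delta> \<le> t\<^sup>2 * \<rho> (h - (- (1 / t)) *\<^sub>R d) (h - (- (1 / t)) *\<^sub>R d)"
        by (intro mult_left_mono) auto
      also have "\<dots> = \<rho> (t *\<^sub>R (h - (- (1 / t)) *\<^sub>R d)) (t *\<^sub>R (h - (- (1 / t)) *\<^sub>R d))"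
        by (rule form_scale[OF \<rho>, symmetric])
      also have "t *\<^sub>R (h - (- (1 / t)) *\<^sub>R d) = x"
        using False d(2) by (simp add: algebra_simps)
      finally have "sqrt (t\<^sup>2 * \<delta>) \<le> sqrt (\<rho> x x)" by simp
      then have "\<bar>t\<bar> * ?s \<le> sqrt (\<rho> x x)" by (simp add: real_sqrt_mult)
      moreover have "t * ?s \<le> \<bar>t\<bar> * ?s" using \<delta> by (intro mult_right_mono) auto
      ultimately show ?thesis using d(3) by simp
    qed
  qed
  have scale: "sqrt (\<rho> (c *\<^sub>R x) (c *\<^sub>R x)) = \<bar>c\<bar> * sqrt (\<rho> x x)" for c x
    by (simp add: form_scale[OF \<rho>] real_sqrt_mult)
  have bound: "sqrt (\<rho> x x) \<le> sqrt \<bar>C\<bar> * norm x" for x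
  proof -
    have "\<rho> x x \<le> \<bar>C\<bar> * (norm x)\<^sup>2"
      by (rule order_trans[OF formD(4)[OF \<rho>]]) (simp add: mult_right_mono)
    then have "sqrt (\<rho> x x) \<le> sqrt (\<bar>C\<bar> * (norm x)\<^sup>2)" by (rule real_sqrt_le_mono)
    then show ?thesis by (simp add: real_sqrt_mult)
  qed
  obtain \<phi> :: "'a \<Rightarrow>\<^sub>L real" where \<phi>: "\<And>x. \<bar>blinfun_apply \<phi> x\<bar> \<le> sqrt (\<rho> x x)"
    "\<And>x r. (x, r) \<in> g ` (span D \<times> UNIV) \<Longrightarrow> blinfun_apply \<phi> x = r"
    using dominated_functional[OF form_sqrt_triangle[OF \<rho>] scale bound sub dom] by blast
  have "g (0, 1) \<in> g ` (span D \<times> UNIV)" by (intro imageI) (simp add: span_zero)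
  then have "blinfun_apply \<phi> h = ?s" using \<phi>(2) unfolding g_def by simp
  then have "\<phi> \<noteq> 0" using \<delta> by auto
  moreover have "blinfun_apply \<phi> d = 0" if "d \<in> D" for d
  proof -
    have "g (d, 0) \<in> g ` (span D \<times> UNIV)" using that by (intro imageI) (simp add: span_base)
    then show ?thesis using \<phi>(2) unfolding g_def by simp
  qed
  moreover have "(blinfun_apply \<phi> x)\<^sup>2 \<le> \<rho> x x" for x
  proof -
    have "\<bar>blinfun_apply \<phi> x\<bar>\<^sup>2 \<le> (sqrt (\<rho> x x))\<^sup>2" using \<phi>(1) by (rule power_mono) simp
    then show ?thesis using formD(3)[OF \<rho>, of x] by simp
  qed
  ultimately show ?thesis by blast
qed

text \<open>
  If \<open>d\<close> were close to \<open>h\<close> for the midpoint, it would be so for both forms. Then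
  \<open>\<mu> d d\<close> would be small because \<open>\<mu> h h = 0\<close>, and \<open>\<nu> d d\<close>, being equal to it,
  would be small too, so that \<open>\<nu> h h\<close> would be small.
\<close>

lemma midpoint_form_far_from_span:
  assumes \<mu>: "form C \<mu>" and \<nu>: "form C \<nu>" and agree: "\<And>d d'. d \<in> D \<Longrightarrow> d' \<in> D \<Longrightarrow> \<nu> d d' = \<mu> d d'"
    and h: "\<mu> h h = 0" and d: "d \<in> span D"
  shows "\<nu> h h / 12 \<le> (\<nu> (h - d) (h - d) + \<mu> (h - d) (h - d)) / 2"
proof -
  have "\<nu> d d = \<mu> d d"
    using formD(1)[OF \<nu>] formD(1)[OF \<mu>] order_refl order_refl d d agree by (rule bilinear_eq)
  moreover have "\<mu> d d \<le> 2 * \<mu> (h - d) (h - d)"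
    using form_diff_le[OF \<mu>, of h "h - d"] h by simp
  ultimately have "\<nu> d d \<le> 2 * \<mu> (h - d) (h - d)" by simp
  moreover have "\<nu> h h \<le> 2 * \<nu> d d + 2 * \<nu> (h - d) (h - d)"
    using form_diff_le[OF \<nu>, of d "d - h"] form_commute_diff[OF \<nu>, of d h] by simp
  moreover have "0 \<le> \<nu> (h - d) (h - d)" by (rule formD(3)[OF \<nu>])
  moreover have "0 \<le> \<mu> (h - d) (h - d)" by (rule formD(3)[OF \<mu>])
  ultimately show ?thesis by (simp add: field_simps)
qed

section \<open>Uncountable tightness of the dual ball\<close>

text \<open>
  Membership in the weak* closure, spelled out with basic neighbourhoods.
\<close>

definition weak_star_adherent :: "('a::real_normed_vector \<Rightarrow>\<^sub>L real) \<Rightarrow> ('a \<Rightarrow>\<^sub>L real) set \<Rightarrow> bool"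
  where "weak_star_adherent f A \<longleftrightarrow> (\<forall>F \<epsilon>. finite F \<longrightarrow> \<epsilon> > 0 \<longrightarrow>
    (\<exists>a\<in>A. \<forall>x\<in>F. \<bar>blinfun_apply a x - blinfun_apply f x\<bar> < \<epsilon>))"

lemma in_weak_star_closure_iff: "f \<in> weak_star_topology closure_of A \<longleftrightarrow> weak_star_adherent f A"
proof
  assume f: "f \<in> weak_star_topology closure_of A"
  show "weak_star_adherent f A"
    unfolding weak_star_adherent_def
  proof (intro allI impI)
    fix F :: "'a set" and \<epsilon> :: real assume F: "finite F" "\<epsilon> > 0"
    let ?W = "{g. \<forall>x\<in>F. blinfun_apply g x \<in> ball (blinfun_apply f x) \<epsilon>}"
    have op: "openin weak_star_topology ?W"
      using F(1) by (intro strong_operator_topology_basis) auto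
    have mem: "f \<in> ?W" using F(2) by simp
    have "\<forall>W. f \<in> W \<and> openin weak_star_topology W \<longrightarrow> (\<exists>a. a \<in> A \<and> a \<in> W)"
      using f unfolding in_closure_of by (rule conjunct2)
    from this[rule_format, OF conjI[OF mem op]] obtain a where "a \<in> A" "a \<in> ?W" by (elim exE conjE)
    then show "\<exists>a\<in>A. \<forall>x\<in>F. \<bar>blinfun_apply a x - blinfun_apply f x\<bar> < \<epsilon>"
      by (intro bexI[of _ a]) (auto simp: dist_real_def abs_minus_commute)
  qed
next
  assume f: "weak_star_adherent f A"
  have "\<exists>a\<in>A. a \<in> W" if W: "f \<in> W" "openin weak_star_topology W" for W
  proof -
    obtain V where V: "open V" "W = blinfun_apply -` V"
      using W(2) unfolding strong_operator_topology_def openin_pullback_topology by auto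
    have "openin (product_topology (\<lambda>i. euclidean) UNIV) V" "blinfun_apply f \<in> V"
      using V W(1) by (simp_all add: euclidean_product_topology)
    from product_topology_open_contains_basis[OF this] obtain X where
      X: "blinfun_apply f \<in> PiE UNIV X" "\<And>i. open (X i)" "finite {i. X i \<noteq> UNIV}" "PiE UNIV X \<subseteq> V"
      by auto
    let ?F = "{i. X i \<noteq> UNIV}"
    have "\<forall>i. \<exists>\<epsilon>>0. ball (blinfun_apply f i) \<epsilon> \<subseteq> X i"
      using X(1,2) by (auto simp: open_contains_ball)
    then obtain \<epsilon> where \<epsilon>: "\<And>i. \<epsilon> i > 0" "\<And>i. ball (blinfun_apply f i) (\<epsilon> i) \<subseteq> X i" by metis
    define \<delta> where "\<delta> = Min (insert 1 (\<epsilon> ` ?F))"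
    have \<delta>: "\<delta> > 0" "\<And>i. i \<in> ?F \<Longrightarrow> \<delta> \<le> \<epsilon> i" unfolding \<delta>_def using X(3) \<epsilon>(1) by auto
    obtain a where a: "a \<in> A" "\<And>x. x \<in> ?F \<Longrightarrow> \<bar>blinfun_apply a x - blinfun_apply f x\<bar> < \<delta>"
      using f X(3) \<delta>(1) unfolding weak_star_adherent_def by meson
    have "blinfun_apply a i \<in> X i" for i
    proof (cases "i \<in> ?F")
      case True
      have "blinfun_apply a i \<in> ball (blinfun_apply f i) (\<epsilon> i)"
        using a(2)[OF True] \<delta>(2)[OF True] by (simp add: dist_real_def abs_minus_commute)
      then show ?thesis using \<epsilon>(2) by blast
    qed auto
    then have "blinfun_apply a \<in> V" using X(4) by (auto simp: PiE_UNIV_domain)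
    then show ?thesis using V(2) a(1) by auto
  qed
  then show "f \<in> weak_star_topology closure_of A"
    unfolding in_closure_of by (auto simp: strong_operator_topology_topspace)
qed

text \<open>
  The point witnessing uncountable tightness is moved to \<open>0\<close>, which doubles the radius of the
  ball.
\<close>

lemma not_countably_tight_dual_ball:
  assumes "\<not> countably_tight (dual_ball_weak_star :: ('a::real_normed_vector \<Rightarrow>\<^sub>L real) topology)"
  obtains A :: "('a::real_normed_vector \<Rightarrow>\<^sub>L real) set" where "A \<subseteq> cball 0 2" "weak_star_adherent 0 A"
    "\<And>B. B \<subseteq> A \<Longrightarrow> countable B \<Longrightarrow> \<not> weak_star_adherent 0 B"
proof -
  have cl: "g \<in> dual_ball_weak_star closure_of B \<longleftrightarrow> g \<in> cball 0 1 \<and> weak_star_adherent g B"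
    if "B \<subseteq> cball 0 1" for g :: "'a \<Rightarrow>\<^sub>L real" and B
    using that unfolding dual_ball_weak_star_def closure_of_subtopology
    by (simp add: in_weak_star_closure_iff Int_absorb1)
  have top: "topspace (dual_ball_weak_star :: ('a \<Rightarrow>\<^sub>L real) topology) = cball 0 1"
    unfolding dual_ball_weak_star_def by (simp add: strong_operator_topology_topspace)
  obtain A and f :: "'a \<Rightarrow>\<^sub>L real" where A: "A \<subseteq> cball 0 1" "f \<in> dual_ball_weak_star closure_of A"
    "\<And>B. B \<subseteq> A \<Longrightarrow> countable B \<Longrightarrow> f \<notin> dual_ball_weak_star closure_of B"
    using assms unfolding countably_tight_def top by metis
  have f: "f \<in> cball 0 1" "weak_star_adherent f A" using A(2) cl[OF A(1)] by auto
  have f': "\<not> weak_star_adherent f B" if "B \<subseteq> A" "countable B" for B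
    using A(3)[OF that] cl[of B f] that(1) A(1) f(1) by blast
  have shift: "weak_star_adherent 0 ((\<lambda>a. a - f) ` B) \<longleftrightarrow> weak_star_adherent f B" for B
    unfolding weak_star_adherent_def by (simp add: blinfun.diff_left)
  show thesis
  proof (rule that[of "(\<lambda>a. a - f) ` A"])
    show "(\<lambda>a. a - f) ` A \<subseteq> cball 0 2"
    proof
      fix g assume "g \<in> (\<lambda>a. a - f) ` A"
      then obtain a where "a \<in> A" "g = a - f" by blast
      then show "g \<in> cball 0 2" using A(1) f(1) norm_triangle_ineq4[of a f] by auto
    qed
    show "weak_star_adherent 0 ((\<lambda>a. a - f) ` A)" using f(2) shift by blast
    show "\<not> weak_star_adherent 0 B" if B: "B \<subseteq> (\<lambda>a. a - f) ` A" "countable B" for B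
    proof -
      obtain B' where "B' \<subseteq> A" "countable B'" "B = (\<lambda>a. a - f) ` B'"
        using countable_subset_image[of B "\<lambda>a. a - f" A] B by metis
      then show ?thesis using f' shift by blast
    qed
  qed
qed

text \<open>
  The Banach-Alaoglu theorem for sequences of functionals, with the cluster point described by closed
  conditions.
\<close>

lemma functional_cluster_point:
  fixes a :: "nat \<Rightarrow> 'a::real_normed_vector \<Rightarrow>\<^sub>L real"
  assumes a: "\<And>n. norm (a n) \<le> c"
  shows "\<exists>b::'a \<Rightarrow>\<^sub>L real. norm b \<le> c \<and>
    (\<forall>T. closed T \<longrightarrow> eventually (\<lambda>n. blinfun_apply (a n) \<in> T) sequentially \<longrightarrow> blinfun_apply b \<in> T)"
proof -
  let ?K = "{g::'a \<Rightarrow> real. \<forall>x. g x \<in> {- (c * norm x)..c * norm x}}"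
  have "blinfun_apply (a n) \<in> ?K" for n
  proof -
    have "\<bar>blinfun_apply (a n) x\<bar> \<le> c * norm x" for x
      using norm_blinfun[of "a n" x] mult_right_mono[OF a[of n] norm_ge_zero[of x]] by simp
    then show ?thesis by (simp add: abs_le_iff minus_le_iff)
  qed
  then have ev: "eventually (\<lambda>n. blinfun_apply (a n) \<in> ?K) sequentially" by simp
  obtain g where g: "g \<in> ?K"
    "\<forall>T. closed T \<longrightarrow> eventually (\<lambda>n. blinfun_apply (a n) \<in> T) sequentially \<longrightarrow> g \<in> T"
    using compact_filter_cluster[OF compact_functionals sequentially_bot ev] by (elim bexE)
  have bound: "\<bar>g x\<bar> \<le> c * norm x" for x using g(1) by (auto simp: abs_le_iff minus_le_iff)
  have "g \<in> {g. g (x + y) = g x + g y}" for x y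
    by (rule g(2)[rule_format]) (intro closed_Collect_eq continuous_intros continuous_eval, simp add: blinfun.add_right)
  moreover have "g \<in> {g. g (k *\<^sub>R x) = k * g x}" for k x
    by (rule g(2)[rule_format]) (intro closed_Collect_eq continuous_intros continuous_eval, simp add: blinfun.scaleR_right)
  ultimately have "bounded_linear g"
    using bound by (intro bounded_linear_intro[where K = c]) (auto simp: mult.commute)
  then have app: "blinfun_apply (Blinfun g) = g" by (rule bounded_linear_Blinfun_apply)
  have "0 \<le> c" using order_trans[OF norm_ge_zero a] .
  then have "norm (Blinfun g) \<le> c" using bound app by (intro norm_blinfun_bound) auto
  then show ?thesis using g(2) app by (intro exI[of _ "Blinfun g"]) simp
qed

text \<open>
  The family consists of all functionals adherent to a countable subset of the set \<open>A\<close> that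
  witnesses uncountable tightness at \<open>0\<close>. It still does not have \<open>0\<close> in the closure of
  any countable subset, which is the last property. In return it is closed under cluster points of
  sequences, so that the condition of being close to \<open>0\<close> on finite sets can be improved to
  vanishing on a countable set.
\<close>

lemma countably_closed_family:
  assumes "\<not> countably_tight (dual_ball_weak_star :: ('a::real_normed_vector \<Rightarrow>\<^sub>L real) topology)"
  obtains A :: "('a::real_normed_vector \<Rightarrow>\<^sub>L real) set" where "\<And>a. a \<in> A \<Longrightarrow> norm a \<le> 2"
    "\<And>D. countable D \<Longrightarrow> \<exists>a\<in>A. \<forall>x\<in>D. blinfun_apply a x = 0"
    "\<And>B. B \<subseteq> A \<Longrightarrow> countable B \<Longrightarrow>
      \<exists>F \<epsilon>. finite F \<and> \<epsilon> > 0 \<and> (\<forall>b\<in>B. \<epsilon> \<le> (\<Sum>x\<in>F. (blinfun_apply b x)\<^sup>2))"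
proof -
  obtain A :: "('a \<Rightarrow>\<^sub>L real) set" where A: "A \<subseteq> cball 0 2" "weak_star_adherent 0 A"
    "\<And>B. B \<subseteq> A \<Longrightarrow> countable B \<Longrightarrow> \<not> weak_star_adherent 0 B"
    using not_countably_tight_dual_ball[OF assms] by metis
  define A' where "A' = {a. norm a \<le> 2 \<and> (\<exists>B\<subseteq>A. countable B \<and> weak_star_adherent a B)}"
  show thesis
  proof (rule that[of A'])
    show "norm a \<le> 2" if "a \<in> A'" for a using that unfolding A'_def by blast
  next
    fix D :: "'a set" assume D: "countable D"
    obtain d :: "nat \<Rightarrow> 'a" where d: "D \<subseteq> range d"
      using D by (metis countable_empty empty_subsetI order_refl range_from_nat_into)
    have "\<exists>a\<in>A. \<forall>i\<le>n. \<bar>blinfun_apply a (d i)\<bar> < 1 / (real n + 1)" for n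
      using A(2)[unfolded weak_star_adherent_def, rule_format, of "d ` {..n}" "1 / (real n + 1)"] by auto
    then obtain a where a: "\<And>n. a n \<in> A" "\<And>n i. i \<le> n \<Longrightarrow> \<bar>blinfun_apply (a n) (d i)\<bar> < 1 / (real n + 1)"
      by metis
    have "norm (a n) \<le> 2" for n using a(1)[of n] A(1) by auto
    from functional_cluster_point[of a 2, OF this] obtain b where b: "norm b \<le> 2"
      "\<forall>T. closed T \<longrightarrow> eventually (\<lambda>n. blinfun_apply (a n) \<in> T) sequentially \<longrightarrow> blinfun_apply b \<in> T"
      by (elim exE conjE)
    have "weak_star_adherent b (range a)"
      unfolding weak_star_adherent_def
    proof (intro allI impI, rule ccontr)
      fix F :: "'a set" and \<epsilon> :: real
      assume F: "finite F" "\<epsilon> > 0" and none: "\<not> (\<exists>a\<in>range a. \<forall>x\<in>F. \<bar>blinfun_apply a x - blinfun_apply b x\<bar> < \<epsilon>)"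
      let ?U = "\<Inter>x\<in>F. {g. \<bar>g x - blinfun_apply b x\<bar> < \<epsilon>}"
      have "open ?U"
        using F(1) by (intro open_INT ballI open_Collect_less continuous_intros continuous_eval)
      then have "closed (- ?U)" by (rule closed_Compl)
      moreover have "blinfun_apply (a n) \<in> - ?U" for n using none by auto
      ultimately have "blinfun_apply b \<in> - ?U" by (intro b(2)[rule_format]) auto
      then show False using F(2) by simp
    qed
    moreover have "range a \<subseteq> A" using a(1) by blast
    ultimately have bA': "b \<in> A'"
      using b(1) unfolding A'_def by (intro CollectI conjI exI[of _ "range a"]) simp_all
    have "blinfun_apply b (d i) = 0" for i
    proof (rule ccontr)
      assume "blinfun_apply b (d i) \<noteq> 0"
      then obtain m where m: "inverse (real (Suc m)) < \<bar>blinfun_apply b (d i)\<bar>"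
        using reals_Archimedean[of "\<bar>blinfun_apply b (d i)\<bar>"] by auto
      have "blinfun_apply b \<in> {g. \<bar>g (d i)\<bar> \<le> inverse (real (Suc m))}"
      proof (rule b(2)[rule_format])
        show "closed {g::'a \<Rightarrow> real. \<bar>g (d i)\<bar> \<le> inverse (real (Suc m))}"
          by (intro closed_Collect_le continuous_intros continuous_eval)
        show "eventually (\<lambda>n. blinfun_apply (a n) \<in> {g. \<bar>g (d i)\<bar> \<le> inverse (real (Suc m))}) sequentially"
          unfolding eventually_sequentially
        proof (intro exI[of _ "max m i"] allI impI)
          fix n assume n: "max m i \<le> n"
          have "\<bar>blinfun_apply (a n) (d i)\<bar> < 1 / (real n + 1)" using n by (intro a(2)) simp
          also have "\<dots> \<le> inverse (real (Suc m))" using n by (simp add: field_simps)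
          finally show "blinfun_apply (a n) \<in> {g. \<bar>g (d i)\<bar> \<le> inverse (real (Suc m))}" by simp
        qed
      qed
      then show False using m by simp
    qed
    then have "\<forall>x\<in>D. blinfun_apply b x = 0" using d by auto
    then show "\<exists>a\<in>A'. \<forall>x\<in>D. blinfun_apply a x = 0" using bA' by (rule bexI)
  next
    fix B assume B: "B \<subseteq> A'" "countable B"
    have "\<forall>b\<in>B. \<exists>C\<subseteq>A. countable C \<and> weak_star_adherent b C" using B(1) unfolding A'_def by blast
    then obtain C where C: "\<And>b. b \<in> B \<Longrightarrow> C b \<subseteq> A" "\<And>b. b \<in> B \<Longrightarrow> countable (C b)"
      "\<And>b. b \<in> B \<Longrightarrow> weak_star_adherent b (C b)" by metis
    have "\<not> weak_star_adherent 0 (\<Union>b\<in>B. C b)" using C(1,2) B(2) by (intro A(3)) auto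
    then obtain F \<epsilon> where F: "finite F" "\<epsilon> > 0"
      "\<forall>c\<in>(\<Union>b\<in>B. C b). \<exists>x\<in>F. \<epsilon> \<le> \<bar>blinfun_apply c x\<bar>"
      unfolding weak_star_adherent_def by (auto simp: not_less)
    have "(\<epsilon> / 2)\<^sup>2 \<le> (\<Sum>x\<in>F. (blinfun_apply b x)\<^sup>2)" if b: "b \<in> B" for b
    proof -
      obtain c where c: "c \<in> C b" "\<And>x. x \<in> F \<Longrightarrow> \<bar>blinfun_apply c x - blinfun_apply b x\<bar> < \<epsilon> / 2"
        using C(3)[OF b] F(1,2) unfolding weak_star_adherent_def by (meson half_gt_zero)
      then obtain x where x: "x \<in> F" "\<epsilon> \<le> \<bar>blinfun_apply c x\<bar>" using F(3) b by blast
      have "\<epsilon> / 2 \<le> \<bar>blinfun_apply b x\<bar>" using c(2)[OF x(1)] x(2) by linarith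
      then have "(\<epsilon> / 2)\<^sup>2 \<le> \<bar>blinfun_apply b x\<bar>\<^sup>2" using F(2) by (intro power_mono) auto
      also have "\<dots> \<le> (\<Sum>x\<in>F. (blinfun_apply b x)\<^sup>2)"
        using member_le_sum[OF x(1), of "\<lambda>x. (blinfun_apply b x)\<^sup>2"] F(1) by simp
      finally show ?thesis .
    qed
    then show "\<exists>F \<epsilon>. finite F \<and> \<epsilon> > 0 \<and> (\<forall>b\<in>B. \<epsilon> \<le> (\<Sum>x\<in>F. (blinfun_apply b x)\<^sup>2))"
      using F(1,2) by (intro exI[of _ F] exI[of _ "(\<epsilon> / 2)\<^sup>2"]) auto
  qed
qed

section \<open>The well-order of \<open>\<omega>\<^sub>1\<close>\<close>

lemma uncountable_omega1: "\<not> countable (UNIV::omega1 set)"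
proof
  assume "countable (UNIV::omega1 set)"
  then have "countable (range Rep_omega1)" by simp
  then show False
    using uncountable_Field_omega1 type_definition.Rep_range[OF type_definition_omega1] by simp
qed

instantiation omega1 :: wellorder
begin

definition less_eq_omega1 :: "omega1 \<Rightarrow> omega1 \<Rightarrow> bool"
  where "\<alpha> \<le> \<beta> \<longleftrightarrow> (Rep_omega1 \<alpha>, Rep_omega1 \<beta>) \<in> omega1_card"

definition less_omega1 :: "omega1 \<Rightarrow> omega1 \<Rightarrow> bool"
  where "(\<alpha>::omega1) < \<beta> \<longleftrightarrow> \<alpha> \<le> \<beta> \<and> \<alpha> \<noteq> \<beta>"

instance
proof
  have wo: "well_order_on (Field omega1_card) omega1_card"
    by (rule cardSuc_Well_order[OF natLeq_Card_order])
  then have refl: "refl_on (Field omega1_card) omega1_card" and trans: "trans omega1_card"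
    and anti: "antisym omega1_card" and total: "total_on (Field omega1_card) omega1_card"
    and wf: "wf (omega1_card - Id)"
    unfolding well_order_on_def linear_order_on_def partial_order_on_def preorder_on_def by auto
  fix \<alpha> \<beta> \<gamma> :: omega1
  show refl': "\<alpha> \<le> \<alpha>" unfolding less_eq_omega1_def using refl_onD[OF refl Rep_omega1] .
  show trans': "\<alpha> \<le> \<gamma>" if "\<alpha> \<le> \<beta>" "\<beta> \<le> \<gamma>"
    using that transD[OF trans] unfolding less_eq_omega1_def by blast
  have anti': "\<alpha> = \<beta>" if "\<alpha> \<le> \<beta>" "\<beta> \<le> \<alpha>" for \<alpha> \<beta> :: omega1
    using antisymD[OF anti that[unfolded less_eq_omega1_def]] by (simp add: Rep_omega1_inject)
  then show "\<alpha> = \<beta>" if "\<alpha> \<le> \<beta>" "\<beta> \<le> \<alpha>" using that .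
  show "(\<alpha> < \<beta>) = (\<alpha> \<le> \<beta> \<and> \<not> \<beta> \<le> \<alpha>)"
    unfolding less_omega1_def using anti' refl' by metis
  show "\<alpha> \<le> \<beta> \<or> \<beta> \<le> \<alpha>"
  proof (cases "\<alpha> = \<beta>")
    case True
    then show ?thesis using refl' by simp
  next
    case False
    then show ?thesis
      using total Rep_omega1[of \<alpha>] Rep_omega1[of \<beta>]
      unfolding less_eq_omega1_def total_on_def by (simp add: Rep_omega1_inject)
  qed
  fix P :: "omega1 \<Rightarrow> bool"
  assume step: "\<And>\<alpha>. (\<And>\<beta>. \<beta> < \<alpha> \<Longrightarrow> P \<beta>) \<Longrightarrow> P \<alpha>"
  have "\<forall>\<alpha>. Rep_omega1 \<alpha> = x \<longrightarrow> P \<alpha>" for x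
    using wf
  proof (induction x rule: wf_induct_rule)
    case (less x)
    show ?case
    proof (intro allI impI)
      fix \<alpha> assume \<alpha>: "Rep_omega1 \<alpha> = x"
      show "P \<alpha>"
      proof (rule step)
        fix \<beta> assume "\<beta> < \<alpha>"
        then have "(Rep_omega1 \<beta>, x) \<in> omega1_card - Id"
          using \<alpha> unfolding less_omega1_def less_eq_omega1_def by (auto simp: Rep_omega1_inject)
        then show "P \<beta>" using less by blast
      qed
    qed
  qed
  then show "P \<alpha>" by simp
qed

end

lemma countable_initial_segment: "countable {\<beta>::omega1. \<beta> < \<alpha>}"
proof -
  have "card_of (underS omega1_card (Rep_omega1 \<alpha>)) <o omega1_card"
    by (rule card_of_underS[OF cardSuc_Card_order[OF natLeq_Card_order] Rep_omega1])
  then have "card_of (underS omega1_card (Rep_omega1 \<alpha>)) \<le>o natLeq"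
    by (rule cardSuc_ordLeq_ordLess[OF natLeq_Card_order card_of_Card_order, THEN iffD1])
  then have "countable (underS omega1_card (Rep_omega1 \<alpha>))" by (simp only: countable_card_le_natLeq)
  moreover have "Rep_omega1 ` {\<beta>. \<beta> < \<alpha>} \<subseteq> underS omega1_card (Rep_omega1 \<alpha>)"
    unfolding underS_def less_omega1_def less_eq_omega1_def by (auto simp: Rep_omega1_inject)
  ultimately have "countable (Rep_omega1 ` {\<beta>. \<beta> < \<alpha>})" by (rule countable_subset[rotated])
  then show ?thesis by (rule countable_image_inj_on) (simp add: inj_on_def Rep_omega1_inject)
qed

lemma countable_omega1_bounded:
  assumes "countable (S::omega1 set)"
  shows "\<exists>\<gamma>. \<forall>\<alpha>\<in>S. \<alpha> < \<gamma>"
proof (rule ccontr)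
  assume neg: "\<not> ?thesis"
  have "\<gamma> \<in> (\<Union>\<alpha>\<in>S. insert \<alpha> {\<beta>. \<beta> < \<alpha>})" for \<gamma>
  proof -
    obtain \<alpha> where "\<alpha> \<in> S" "\<gamma> \<le> \<alpha>" using neg by (meson not_less)
    then show ?thesis by (auto simp: le_less)
  qed
  then have "UNIV = (\<Union>\<alpha>\<in>S. insert \<alpha> {\<beta>. \<beta> < \<alpha>})" by blast
  moreover have "countable (\<Union>\<alpha>\<in>S. insert \<alpha> {\<beta>. \<beta> < \<alpha>})"
    using assms by (intro countable_UN countable_insert countable_initial_segment)
  ultimately show False using uncountable_omega1 by simp
qed

section \<open>Free sequences of functionals\<close>

text \<open>
  A free sequence of length \<open>\<omega>\<^sub>1\<close>: the set \<open>F \<alpha>\<close> separates all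
  functionals up to \<open>\<alpha>\<close> from \<open>0\<close>, while all later ones vanish on it. Sums of
  squares are used because they depend linearly on the rank-one form of a functional.
\<close>

locale free_functionals =
  fixes a :: "omega1 \<Rightarrow> 'a::real_normed_vector \<Rightarrow>\<^sub>L real"
    and F :: "omega1 \<Rightarrow> 'a set" and \<epsilon> :: "omega1 \<Rightarrow> real"
  assumes norm_a: "norm (a \<alpha>) \<le> 2"
    and finite_F: "finite (F \<alpha>)"
    and \<epsilon>_pos: "\<epsilon> \<alpha> > 0"
    and a_zero: "\<beta> < \<alpha> \<Longrightarrow> x \<in> F \<beta> \<Longrightarrow> blinfun_apply (a \<alpha>) x = 0"
    and a_large: "\<beta> \<le> \<alpha> \<Longrightarrow> \<epsilon> \<alpha> \<le> (\<Sum>x\<in>F \<alpha>. (blinfun_apply (a \<beta>) x)\<^sup>2)"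

text \<open>
  At stage \<open>\<alpha>\<close> only countably many vectors and functionals have been chosen. So there is a functional
  that vanishes on all these vectors, and then a finite set that separates it and all earlier functionals
  from \<open>0\<close>.
\<close>

lemma free_functionals_exist:
  fixes A :: "('a::real_normed_vector \<Rightarrow>\<^sub>L real) set"
  assumes A: "\<And>a. a \<in> A \<Longrightarrow> norm a \<le> 2"
    and zero: "\<And>D. countable D \<Longrightarrow> \<exists>a\<in>A. \<forall>x\<in>D. blinfun_apply a x = 0"
    and large: "\<And>B. B \<subseteq> A \<Longrightarrow> countable B \<Longrightarrow>
      \<exists>F \<epsilon>. finite F \<and> \<epsilon> > 0 \<and> (\<forall>b\<in>B. \<epsilon> \<le> (\<Sum>x\<in>F. (blinfun_apply b x)\<^sup>2))"
  shows "\<exists>(a :: omega1 \<Rightarrow> 'a \<Rightarrow>\<^sub>L real) F \<epsilon>. free_functionals a F \<epsilon>"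
proof -
  define P where "P f \<alpha> r \<longleftrightarrow> fst r \<in> A \<and> finite (fst (snd r)) \<and> snd (snd r) > 0 \<and>
      (\<forall>\<beta><\<alpha>. \<forall>x\<in>fst (snd (f \<beta>)). blinfun_apply (fst r) x = 0) \<and>
      (\<forall>\<beta><\<alpha>. snd (snd r) \<le> (\<Sum>x\<in>fst (snd r). (blinfun_apply (fst (f \<beta>)) x)\<^sup>2)) \<and>
      snd (snd r) \<le> (\<Sum>x\<in>fst (snd r). (blinfun_apply (fst r) x)\<^sup>2)"
    for f :: "omega1 \<Rightarrow> ('a \<Rightarrow>\<^sub>L real) \<times> 'a set \<times> real" and \<alpha> r
  have "\<exists>f. \<forall>\<alpha>. P f \<alpha> (f \<alpha>)"
  proof (rule dependent_wellorder_choice)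
    show "P f \<alpha> r = P g \<alpha> r" if "\<And>\<beta>. \<beta> < \<alpha> \<Longrightarrow> f \<beta> = g \<beta>" for r f g \<alpha>
      unfolding P_def using that by simp
  next
    fix \<alpha> f assume IH: "\<And>\<beta>. \<beta> < \<alpha> \<Longrightarrow> P f \<beta> (f \<beta>)"
    have "countable (\<Union>\<beta>\<in>{\<beta>. \<beta> < \<alpha>}. fst (snd (f \<beta>)))"
      using IH unfolding P_def by (intro countable_UN countable_initial_segment countable_finite) simp
    then obtain b where b: "b \<in> A" "\<forall>x\<in>(\<Union>\<beta>\<in>{\<beta>. \<beta> < \<alpha>}. fst (snd (f \<beta>))). blinfun_apply b x = 0"
      using zero by blast
    let ?B = "insert b ((\<lambda>\<beta>. fst (f \<beta>)) ` {\<beta>. \<beta> < \<alpha>})"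
    have "?B \<subseteq> A" using b(1) IH unfolding P_def by auto
    moreover have "countable ?B" by (intro countable_insert countable_image countable_initial_segment)
    ultimately obtain G e where "finite G" "e > 0" "\<forall>c\<in>?B. e \<le> (\<Sum>x\<in>G. (blinfun_apply c x)\<^sup>2)"
      using large by meson
    then have "P f \<alpha> (b, G, e)" using b unfolding P_def by auto
    then show "\<exists>r. P f \<alpha> r" by blast
  qed
  then obtain f where f: "\<And>\<alpha>. P f \<alpha> (f \<alpha>)" by blast
  show ?thesis
  proof (intro exI)
    show "free_functionals (\<lambda>\<alpha>. fst (f \<alpha>)) (\<lambda>\<alpha>. fst (snd (f \<alpha>))) (\<lambda>\<alpha>. snd (snd (f \<alpha>)))"
    proof
      fix \<alpha> \<beta> x
      show "norm (fst (f \<alpha>)) \<le> 2" using f[of \<alpha>] A unfolding P_def by blast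
      show "finite (fst (snd (f \<alpha>)))" "snd (snd (f \<alpha>)) > 0" using f[of \<alpha>] unfolding P_def by auto
      show "blinfun_apply (fst (f \<alpha>)) x = 0" if "\<beta> < \<alpha>" "x \<in> fst (snd (f \<beta>))"
        using f[of \<alpha>] that unfolding P_def by blast
      show "snd (snd (f \<alpha>)) \<le> (\<Sum>x\<in>fst (snd (f \<alpha>)). (blinfun_apply (fst (f \<beta>)) x)\<^sup>2)" if "\<beta> \<le> \<alpha>"
        using f[of \<alpha>] that unfolding P_def le_less by blast
    qed
  qed
qed

context free_functionals
begin

text \<open>
  The conditions satisfied by the rank-one forms of the functionals with index between \<open>\<alpha>\<close>
  and \<open>\<gamma>\<close>. They define a compact convex set, which takes the place of the closed convex
  hull of these forms.
\<close>

definition segment_forms :: "omega1 \<Rightarrow> omega1 \<Rightarrow> ('a \<Rightarrow> 'a \<Rightarrow> real) set"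
  where "segment_forms \<alpha> \<gamma> = {\<nu>. form 4 \<nu> \<and> (\<forall>\<beta><\<alpha>. \<forall>h\<in>F \<beta>. \<nu> h h = 0) \<and>
    (\<forall>\<delta>\<ge>\<gamma>. \<epsilon> \<delta> \<le> (\<Sum>h\<in>F \<delta>. \<nu> h h))}"

definition tail_forms :: "omega1 \<Rightarrow> ('a \<Rightarrow> 'a \<Rightarrow> real) set"
  where "tail_forms \<alpha> = (\<Union>\<gamma>. segment_forms \<alpha> \<gamma>)"

text \<open>
  The forms that are approximated arbitrarily far out in the sequence.
\<close>

definition limit_forms :: "('a \<Rightarrow> 'a \<Rightarrow> real) set"
  where "limit_forms = (\<Inter>\<alpha>. closure (tail_forms \<alpha>))"

lemma segment_forms_mono: "\<alpha>' \<le> \<alpha> \<Longrightarrow> \<gamma> \<le> \<gamma>' \<Longrightarrow> segment_forms \<alpha> \<gamma> \<subseteq> segment_forms \<alpha>' \<gamma>'"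
  unfolding segment_forms_def by (auto intro: less_le_trans order_trans)

lemma tail_forms_mono: "\<alpha>' \<le> \<alpha> \<Longrightarrow> tail_forms \<alpha> \<subseteq> tail_forms \<alpha>'"
  unfolding tail_forms_def using segment_forms_mono[OF _ order_refl] by blast

lemma closed_segment_forms: "closed (segment_forms \<alpha> \<gamma>)"
proof -
  have "closed {\<nu>::'a \<Rightarrow> 'a \<Rightarrow> real. \<forall>\<beta>. \<forall>h. \<beta> < \<alpha> \<and> h \<in> F \<beta> \<longrightarrow> \<nu> h h = 0}"
    by (intro closed_Collect_all closed_Collect_imp closed_Collect_eq continuous_eval2
        continuous_on_const open_Collect_const)
  moreover have "closed {\<nu>::'a \<Rightarrow> 'a \<Rightarrow> real. \<forall>\<delta>. \<gamma> \<le> \<delta> \<longrightarrow> \<epsilon> \<delta> \<le> (\<Sum>h\<in>F \<delta>. \<nu> h h)}"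
    by (intro closed_Collect_all closed_Collect_imp closed_Collect_le continuous_on_sum continuous_eval2
        continuous_on_const open_Collect_const)
  ultimately have "closed ({\<nu>. form 4 \<nu>} \<inter> {\<nu>. \<forall>\<beta>. \<forall>h. \<beta> < \<alpha> \<and> h \<in> F \<beta> \<longrightarrow> \<nu> h h = 0} \<inter>
      {\<nu>. \<forall>\<delta>. \<gamma> \<le> \<delta> \<longrightarrow> \<epsilon> \<delta> \<le> (\<Sum>h\<in>F \<delta>. \<nu> h h)})"
    by (intro closed_Int closed_form)
  also have "\<dots> = segment_forms \<alpha> \<gamma>" unfolding segment_forms_def by auto
  finally show ?thesis .
qed

lemma compact_segment_forms: "compact (segment_forms \<alpha> \<gamma>)"
proof -
  have "compact ({\<nu>. form 4 \<nu>} \<inter> segment_forms \<alpha> \<gamma>)"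
    by (rule compact_Int_closed[OF compact_form closed_segment_forms])
  also have "{\<nu>. form 4 \<nu>} \<inter> segment_forms \<alpha> \<gamma> = segment_forms \<alpha> \<gamma>"
    unfolding segment_forms_def by blast
  finally show ?thesis .
qed

lemma form_tail_forms: "\<nu> \<in> tail_forms \<alpha> \<Longrightarrow> form 4 \<nu>"
  unfolding tail_forms_def segment_forms_def by blast

lemma form_limit_forms:
  assumes "\<mu> \<in> limit_forms"
  shows "form 4 \<mu>"
proof -
  have "closure (tail_forms \<alpha>) \<subseteq> {\<nu>. form 4 \<nu>}" for \<alpha>
    using form_tail_forms by (intro closure_minimal closed_form) blast
  then show ?thesis using assms unfolding limit_forms_def by blast
qed

lemma limit_forms_vanish:
  assumes "\<mu> \<in> limit_forms" "h \<in> F \<beta>"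
  shows "\<mu> h h = 0"
proof -
  obtain \<alpha> where "\<beta> < \<alpha>" using countable_omega1_bounded[of "{\<beta>}"] by auto
  then have "tail_forms \<alpha> \<subseteq> {\<nu>. \<nu> h h = 0}"
    using assms(2) unfolding tail_forms_def segment_forms_def by blast
  then have "closure (tail_forms \<alpha>) \<subseteq> {\<nu>. \<nu> h h = 0}"
    by (rule closure_minimal) (intro closed_Collect_eq continuous_eval2 continuous_on_const)
  then show ?thesis using assms(1) unfolding limit_forms_def by blast
qed

lemma squares_in_tail_forms: "(\<lambda>x y. blinfun_apply (a \<alpha>) x * blinfun_apply (a \<alpha>) y) \<in> tail_forms \<alpha>"
proof -
  let ?\<nu> = "\<lambda>x y. blinfun_apply (a \<alpha>) x * blinfun_apply (a \<alpha>) y"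
  have "form 4 ?\<nu>"
    unfolding form_def
  proof (intro conjI allI)
    show "bilinear ?\<nu>"
      unfolding bilinear_def
      by (auto intro!: linearI simp: blinfun.add_right blinfun.scaleR_right algebra_simps)
    show "?\<nu> x x \<le> 4 * (norm x)\<^sup>2" for x
    proof -
      have "\<bar>blinfun_apply (a \<alpha>) x\<bar> \<le> 2 * norm x"
        using norm_blinfun[of "a \<alpha>" x] mult_right_mono[OF norm_a[of \<alpha>] norm_ge_zero[of x]] by simp
      then have "\<bar>blinfun_apply (a \<alpha>) x\<bar>\<^sup>2 \<le> (2 * norm x)\<^sup>2" by (rule power_mono) simp
      then show ?thesis by (simp add: power_mult_distrib power2_eq_square)
    qed
  qed auto
  then have "?\<nu> \<in> segment_forms \<alpha> \<alpha>"
    unfolding segment_forms_def using a_zero a_large by (simp flip: power2_eq_square)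
  then show ?thesis unfolding tail_forms_def by blast
qed

text \<open>
  The assumption on \<open>q\<close> says that it is a cluster point of \<open>p\<close> along the cocountable
  filter of \<open>S\<close>.
\<close>

lemma cluster_in_limit_forms:
  assumes S: "\<And>T. closed T \<Longrightarrow> countable {\<beta>\<in>S. p \<beta> \<notin> T} \<Longrightarrow> q \<in> T"
    and p: "\<And>\<beta>. \<beta> \<in> S \<Longrightarrow> p \<beta> \<in> closure (tail_forms \<beta>)"
  shows "q \<in> limit_forms"
  unfolding limit_forms_def
proof
  fix \<alpha>
  show "q \<in> closure (tail_forms \<alpha>)"
  proof (rule S)
    have "p \<beta> \<in> closure (tail_forms \<alpha>)" if "\<beta> \<in> S" "\<not> \<beta> < \<alpha>" for \<beta>
      using p[OF that(1)] closure_mono[OF tail_forms_mono[of \<alpha> \<beta>]] that(2) by (auto simp: not_less)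
    then have "{\<beta>\<in>S. p \<beta> \<notin> closure (tail_forms \<alpha>)} \<subseteq> {\<beta>. \<beta> < \<alpha>}" by blast
    then show "countable {\<beta>\<in>S. p \<beta> \<notin> closure (tail_forms \<alpha>)}"
      by (rule countable_subset[OF _ countable_initial_segment])
  qed simp
qed

lemma limit_forms_nonempty: "limit_forms \<noteq> {}"
proof -
  let ?p = "\<lambda>\<alpha> x y. blinfun_apply (a \<alpha>) x * blinfun_apply (a \<alpha>) y"
  have "\<forall>\<^sub>F \<alpha> in cocountable UNIV. ?p \<alpha> \<in> {b. form 4 b}"
    using form_tail_forms[OF squares_in_tail_forms] by (simp add: eventually_cocountable)
  from compact_filter_cluster[OF compact_form cocountable_neq_bot[OF uncountable_omega1] this]
  obtain q where q: "\<forall>T. closed T \<longrightarrow> (\<forall>\<^sub>F \<alpha> in cocountable UNIV. ?p \<alpha> \<in> T) \<longrightarrow> q \<in> T"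
    by (elim bexE)
  have "q \<in> limit_forms"
  proof (rule cluster_in_limit_forms[of UNIV ?p])
    show "q \<in> T" if "closed T" "countable {\<beta> \<in> UNIV. ?p \<beta> \<notin> T}" for T
      using q that by (simp add: eventually_cocountable)
    show "?p \<beta> \<in> closure (tail_forms \<beta>)" for \<beta>
      using squares_in_tail_forms[of \<beta>] closure_subset by blast
  qed
  then show ?thesis by blast
qed

text \<open>
  Agreement on a countable set is reached through a sequence of better and better approximations from the
  tail. Its members belong to countably many segments, hence to a single compact one, which therefore
  contains a cluster point of the sequence.
\<close>

lemma limit_form_agrees_with_tail_form:
  assumes \<mu>: "\<mu> \<in> limit_forms" and D: "countable D"
  shows "\<exists>\<nu>\<in>tail_forms \<alpha>. \<forall>x\<in>D. \<forall>y\<in>D. \<nu> x y = \<mu> x y"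
proof -
  obtain e :: "nat \<Rightarrow> 'a \<times> 'a" where e: "D \<times> D \<subseteq> range e"
  proof (cases "D = {}")
    case False
    then show ?thesis
      using that[of "from_nat_into (D \<times> D)"] D by (simp add: range_from_nat_into)
  qed (use that in auto)
  have "\<exists>\<nu>\<in>tail_forms \<alpha>. \<forall>i\<le>n. \<bar>\<nu> (fst (e i)) (snd (e i)) - \<mu> (fst (e i)) (snd (e i))\<bar> < inverse (real (Suc n))" for n
  proof -
    let ?U = "\<Inter>i\<in>{..n}. {\<nu>. \<bar>\<nu> (fst (e i)) (snd (e i)) - \<mu> (fst (e i)) (snd (e i))\<bar> < inverse (real (Suc n))}"
    have "open ?U"
      by (intro open_INT ballI open_Collect_less continuous_intros continuous_eval2) auto
    moreover have "\<mu> \<in> ?U" by simp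
    moreover have "\<mu> \<in> closure (tail_forms \<alpha>)" using \<mu> unfolding limit_forms_def by blast
    ultimately have "?U \<inter> tail_forms \<alpha> \<noteq> {}" using open_Int_closure_eq_empty[of ?U "tail_forms \<alpha>"] by blast
    then show ?thesis by auto
  qed
  then obtain \<nu> where \<nu>: "\<And>n. \<nu> n \<in> tail_forms \<alpha>" "\<And>n i. i \<le> n \<Longrightarrow>
      \<bar>\<nu> n (fst (e i)) (snd (e i)) - \<mu> (fst (e i)) (snd (e i))\<bar> < inverse (real (Suc n))"
    by metis
  have "\<exists>\<gamma>. \<nu> n \<in> segment_forms \<alpha> \<gamma>" for n
    using \<nu>(1)[of n] unfolding tail_forms_def by simp
  then obtain g where g: "\<And>n. \<nu> n \<in> segment_forms \<alpha> (g n)" by metis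
  obtain \<gamma> where \<gamma>: "\<And>n. g n < \<gamma>" using countable_omega1_bounded[of "range g"] by auto
  have "\<nu> n \<in> segment_forms \<alpha> \<gamma>" for n
    using g[of n] segment_forms_mono[OF order_refl less_imp_le[OF \<gamma>[of n]]] by blast
  then have "eventually (\<lambda>n. \<nu> n \<in> segment_forms \<alpha> \<gamma>) sequentially" by simp
  from compact_filter_cluster[OF compact_segment_forms sequentially_bot this]
  obtain q where q: "q \<in> segment_forms \<alpha> \<gamma>"
    "\<forall>T. closed T \<longrightarrow> eventually (\<lambda>n. \<nu> n \<in> T) sequentially \<longrightarrow> q \<in> T"
    by (elim bexE)
  have "q (fst (e i)) (snd (e i)) = \<mu> (fst (e i)) (snd (e i))" (is "?q = ?\<mu>") for i
  proof (rule ccontr)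
    assume "?q \<noteq> ?\<mu>"
    then obtain m where m: "inverse (real (Suc m)) < \<bar>?q - ?\<mu>\<bar>"
      using reals_Archimedean[of "\<bar>?q - ?\<mu>\<bar>"] by auto
    have "q \<in> {b. \<bar>b (fst (e i)) (snd (e i)) - ?\<mu>\<bar> \<le> inverse (real (Suc m))}"
    proof (rule q(2)[rule_format])
      show "closed {b::'a \<Rightarrow> 'a \<Rightarrow> real. \<bar>b (fst (e i)) (snd (e i)) - ?\<mu>\<bar> \<le> inverse (real (Suc m))}"
        by (intro closed_Collect_le continuous_intros continuous_eval2)
      show "eventually (\<lambda>n. \<nu> n \<in> {b. \<bar>b (fst (e i)) (snd (e i)) - ?\<mu>\<bar> \<le> inverse (real (Suc m))}) sequentially"
        unfolding eventually_sequentially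
      proof (intro exI[of _ "max m i"] allI impI)
        fix n assume n: "max m i \<le> n"
        have "\<bar>\<nu> n (fst (e i)) (snd (e i)) - ?\<mu>\<bar> < inverse (real (Suc n))" using n by (intro \<nu>(2)) simp
        also have "\<dots> \<le> inverse (real (Suc m))" using n by (intro le_imp_inverse_le) auto
        finally show "\<nu> n \<in> {b. \<bar>b (fst (e i)) (snd (e i)) - ?\<mu>\<bar> \<le> inverse (real (Suc m))}" by simp
      qed
    qed
    then show False using m by simp
  qed
  note agree = this
  have "q x y = \<mu> x y" if xy: "x \<in> D" "y \<in> D" for x y
  proof -
    have "(x, y) \<in> range e" using e xy by blast
    then obtain i where "e i = (x, y)" by (metis imageE)
    then show ?thesis using agree[of i] by simp
  qed
  moreover have "q \<in> tail_forms \<alpha>" using q(1) unfolding tail_forms_def by blast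
  ultimately show ?thesis by blast
qed

lemma tail_form_nonzero:
  assumes "\<nu> \<in> tail_forms \<alpha>"
  shows "\<exists>\<beta>. \<exists>h\<in>F \<beta>. \<nu> h h > 0"
proof -
  obtain \<gamma> where "\<nu> \<in> segment_forms \<alpha> \<gamma>" using assms unfolding tail_forms_def by blast
  then have "0 < (\<Sum>h\<in>F \<gamma>. \<nu> h h)"
    using \<epsilon>_pos[of \<gamma>] unfolding segment_forms_def by (auto intro: less_le_trans)
  then show ?thesis by (meson not_less sum_nonpos)
qed

lemma midpoint_in_segment_forms:
  assumes "\<nu> \<in> segment_forms \<alpha> \<gamma>" "\<nu>' \<in> segment_forms \<alpha> \<gamma>"
  shows "(\<lambda>x y. (\<nu> x y + \<nu>' x y) / 2) \<in> segment_forms \<alpha> \<gamma>"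
proof -
  have f: "form 4 \<nu>" "form 4 \<nu>'" using assms unfolding segment_forms_def by blast+
  have "form 4 (\<lambda>x y. (\<nu> x y + \<nu>' x y) / 2)"
    unfolding form_def
  proof (intro conjI allI)
    show "bilinear (\<lambda>x y. (\<nu> x y + \<nu>' x y) / 2)"
      unfolding bilinear_def using formD(1)[OF f(1)] formD(1)[OF f(2)]
      by (auto intro!: linearI simp: bilinear_ladd bilinear_radd bilinear_lmul bilinear_rmul field_simps)
    show "(\<nu> x y + \<nu>' x y) / 2 = (\<nu> y x + \<nu>' y x) / 2" for x y
      using formD(2)[OF f(1), of x y] formD(2)[OF f(2), of x y] by simp
    show "0 \<le> (\<nu> x x + \<nu>' x x) / 2" for x
      using formD(3)[OF f(1), of x] formD(3)[OF f(2), of x] by simp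
    show "(\<nu> x x + \<nu>' x x) / 2 \<le> 4 * (norm x)\<^sup>2" for x
      using formD(4)[OF f(1), of x] formD(4)[OF f(2), of x] by simp
  qed
  moreover have "\<epsilon> \<delta> \<le> (\<Sum>h\<in>F \<delta>. (\<nu> h h + \<nu>' h h) / 2)" if "\<gamma> \<le> \<delta>" for \<delta>
  proof -
    have "\<epsilon> \<delta> \<le> (\<Sum>h\<in>F \<delta>. \<nu> h h)" "\<epsilon> \<delta> \<le> (\<Sum>h\<in>F \<delta>. \<nu>' h h)"
      using assms that unfolding segment_forms_def by blast+
    then show ?thesis by (simp add: sum.distrib flip: sum_divide_distrib)
  qed
  ultimately show ?thesis using assms unfolding segment_forms_def by simp
qed

lemma midpoint_in_closure_tail_forms:
  assumes \<nu>: "\<nu> \<in> tail_forms \<alpha>" and \<mu>: "\<mu> \<in> limit_forms"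
  shows "(\<lambda>x y. (\<nu> x y + \<mu> x y) / 2) \<in> closure (tail_forms \<alpha>)"
proof -
  let ?m = "\<lambda>\<nu>' x y. (\<nu> x y + \<nu>' x y) / 2"
  have "?m ` closure (tail_forms \<alpha>) \<subseteq> closure (tail_forms \<alpha>)"
  proof (rule image_closure_subset)
    have "continuous_on UNIV ?m"
      by (intro continuous_on_coordinatewise_then_product continuous_intros continuous_eval2) simp
    then show "continuous_on (closure (tail_forms \<alpha>)) ?m" by (rule continuous_on_subset) simp
    show "?m ` tail_forms \<alpha> \<subseteq> closure (tail_forms \<alpha>)"
    proof
      fix b assume "b \<in> ?m ` tail_forms \<alpha>"
      then obtain \<nu>' where \<nu>': "\<nu>' \<in> tail_forms \<alpha>" "b = ?m \<nu>'" by blast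
      obtain \<gamma> \<gamma>' where "\<nu> \<in> segment_forms \<alpha> \<gamma>" "\<nu>' \<in> segment_forms \<alpha> \<gamma>'"
        using \<nu> \<nu>'(1) unfolding tail_forms_def by blast
      then have "\<nu> \<in> segment_forms \<alpha> (max \<gamma> \<gamma>')" "\<nu>' \<in> segment_forms \<alpha> (max \<gamma> \<gamma>')"
        using segment_forms_mono[OF order_refl max.cobounded1] segment_forms_mono[OF order_refl max.cobounded2]
        by blast+
      then have "b \<in> segment_forms \<alpha> (max \<gamma> \<gamma>')" unfolding \<nu>'(2) by (rule midpoint_in_segment_forms)
      then have "b \<in> tail_forms \<alpha>" unfolding tail_forms_def by blast
      then show "b \<in> closure (tail_forms \<alpha>)" using closure_subset by blast
    qed
  qed simp
  moreover have "\<mu> \<in> closure (tail_forms \<alpha>)" using \<mu> unfolding limit_forms_def by blast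
  ultimately show ?thesis by blast
qed

text \<open>
  Tail forms are nonzero at some vector of the sets \<open>F \<beta>\<close>, on all of which limit forms vanish. So a tail
  form \<open>\<nu>\<close> differs from \<open>\<mu>\<close> even if they agree on \<open>D\<close>, and the difference is
  witnessed by a functional that vanishes on \<open>D\<close>. Averaging \<open>\<nu>\<close> with
  \<open>\<mu>\<close> is what separates \<open>h\<close> from the span of \<open>D\<close>, and it does not lead out of the
  closure of the tail.
\<close>

lemma residual_functional_exists:
  assumes \<mu>: "\<mu> \<in> limit_forms" and D: "countable D"
  shows "\<exists>(\<phi>::'a \<Rightarrow>\<^sub>L real) \<rho>. \<phi> \<noteq> 0 \<and> \<rho> \<in> closure (tail_forms \<alpha>) \<and> form 4 \<rho> \<and>
    (\<forall>x. (blinfun_apply \<phi> x)\<^sup>2 \<le> \<rho> x x) \<and> (\<forall>d\<in>D. blinfun_apply \<phi> d = 0) \<and>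
    (\<forall>d\<in>D. \<forall>d'\<in>D. \<rho> d d' = \<mu> d d')"
proof -
  obtain \<nu> where \<nu>: "\<nu> \<in> tail_forms \<alpha>" "\<And>d d'. d \<in> D \<Longrightarrow> d' \<in> D \<Longrightarrow> \<nu> d d' = \<mu> d d'"
    using limit_form_agrees_with_tail_form[OF \<mu> D, of \<alpha>] by blast
  obtain \<beta> h where h: "h \<in> F \<beta>" "\<nu> h h > 0" using tail_form_nonzero[OF \<nu>(1)] by blast
  define \<rho> where "\<rho> x y = (\<nu> x y + \<mu> x y) / 2" for x y
  have cl: "\<rho> \<in> closure (tail_forms \<alpha>)"
    using midpoint_in_closure_tail_forms[OF \<nu>(1) \<mu>] unfolding \<rho>_def[abs_def] .
  have "closure (tail_forms \<alpha>) \<subseteq> {b. form 4 b}"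
    using form_tail_forms by (intro closure_minimal closed_form) blast
  then have \<rho>: "form 4 \<rho>" using cl by blast
  have "\<exists>\<phi>::'a \<Rightarrow>\<^sub>L real. \<phi> \<noteq> 0 \<and> (\<forall>x. (blinfun_apply \<phi> x)\<^sup>2 \<le> \<rho> x x) \<and> (\<forall>d\<in>D. blinfun_apply \<phi> d = 0)"
  proof (rule form_residual_functional[OF \<rho>, of "\<nu> h h / 12" D h])
    show "\<nu> h h / 12 > 0" using h(2) by simp
    show "\<nu> h h / 12 \<le> \<rho> (h - d) (h - d)" if "d \<in> span D" for d
      unfolding \<rho>_def
      by (rule midpoint_form_far_from_span[OF form_limit_forms[OF \<mu>] form_tail_forms[OF \<nu>(1)] \<nu>(2)
            limit_forms_vanish[OF \<mu> h(1)] that])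
  qed
  moreover have "\<rho> d d' = \<mu> d d'" if "d \<in> D" "d' \<in> D" for d d'
    using \<nu>(2)[OF that] unfolding \<rho>_def by simp
  ultimately show ?thesis using cl \<rho> by metis
qed

text \<open>
  In the separable case, let \<open>\<phi> \<alpha>\<close> vanish on \<open>D\<close> and be dominated by a form
  \<open>\<rho> \<alpha>\<close> in the closure of the tail beyond \<open>\<alpha>\<close>. If uncountably many
  \<open>\<phi> \<alpha>\<close> were bounded away from \<open>0\<close> at a vector \<open>x\<close>, a common cluster point of
  these \<open>\<phi> \<alpha>\<close> and \<open>\<rho> \<alpha>\<close> would give an additive function nonzero at
  \<open>x\<close>, vanishing on \<open>D\<close> and dominated by a limit form for which \<open>D\<close> is dense, which is
  impossible.
\<close>

lemma annihilating_family: "\<exists>\<Phi>::('a \<Rightarrow>\<^sub>L real) set. annihilates \<Phi> \<and> card_of \<Phi> \<le>o omega1_card"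
proof (cases "\<exists>b\<in>limit_forms. \<exists>\<eta>>0. \<exists>E. \<not> countable E \<and>
    (\<forall>x\<in>E. \<forall>y\<in>E. x \<noteq> y \<longrightarrow> \<eta> \<le> b (x - y) (x - y))")
  case True
  then obtain b \<eta> E where b: "b \<in> limit_forms" and E: "\<not> countable E" and \<eta>: "\<eta> > 0"
    and sep: "\<forall>x\<in>E. \<forall>y\<in>E. x \<noteq> y \<longrightarrow> \<eta> \<le> b (x - y) (x - y)"
    by blast
  show ?thesis
    by (rule annihilating_family_of_nonseparable_form[OF form_limit_forms[OF b] E \<eta> sep[rule_format]])
next
  case False
  have closed: "closed limit_forms" unfolding limit_forms_def by (intro closed_INT ballI closed_closure)
  have countable_sep: "countable E" if "b \<in> limit_forms" "\<eta> > 0"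
    "\<And>x y. x \<in> E \<Longrightarrow> y \<in> E \<Longrightarrow> x \<noteq> y \<Longrightarrow> \<eta> \<le> b (x - y) (x - y)" for b E and \<eta> :: real
    using False that by blast
  obtain \<mu> D where \<mu>: "\<mu> \<in> limit_forms" and D: "countable D"
    and dense: "\<And>b x \<eta>. b \<in> limit_forms \<Longrightarrow> (\<And>d d'. d \<in> D \<Longrightarrow> d' \<in> D \<Longrightarrow> b d d' = \<mu> d d') \<Longrightarrow>
      \<eta> > 0 \<Longrightarrow> \<exists>d\<in>D. b (x - d) (x - d) < \<eta>"
    by (rule form_determining_set[OF closed limit_forms_nonempty form_limit_forms countable_sep]) blast+
  have "\<forall>\<alpha>. \<exists>(\<phi>::'a \<Rightarrow>\<^sub>L real) \<rho>. \<phi> \<noteq> 0 \<and> \<rho> \<in> closure (tail_forms \<alpha>) \<and> form 4 \<rho> \<and>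
      (\<forall>x. (blinfun_apply \<phi> x)\<^sup>2 \<le> \<rho> x x) \<and> (\<forall>d\<in>D. blinfun_apply \<phi> d = 0) \<and>
      (\<forall>d\<in>D. \<forall>d'\<in>D. \<rho> d d' = \<mu> d d')"
    using residual_functional_exists[OF \<mu> D] by blast
  then obtain \<phi> :: "omega1 \<Rightarrow> 'a \<Rightarrow>\<^sub>L real" and \<rho> where
    nz: "\<And>\<alpha>. \<phi> \<alpha> \<noteq> 0" and tail: "\<And>\<alpha>. \<rho> \<alpha> \<in> closure (tail_forms \<alpha>)" and form: "\<And>\<alpha>. form 4 (\<rho> \<alpha>)"
    and le: "\<And>\<alpha> x. (blinfun_apply (\<phi> \<alpha>) x)\<^sup>2 \<le> \<rho> \<alpha> x x"
    and zero: "\<And>\<alpha> d. d \<in> D \<Longrightarrow> blinfun_apply (\<phi> \<alpha>) d = 0"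
    and agree: "\<And>\<alpha> d d'. d \<in> D \<Longrightarrow> d' \<in> D \<Longrightarrow> \<rho> \<alpha> d d' = \<mu> d d'"
    by metis
  show ?thesis
  proof (rule annihilating_cocountable_family[OF uncountable_omega1, of \<phi>])
    show "\<phi> \<alpha> \<noteq> 0" for \<alpha> by (rule nz)
    fix x
    have small: "countable {\<alpha>. \<delta> \<le> \<bar>blinfun_apply (\<phi> \<alpha>) x\<bar>}" (is "countable ?S") if \<delta>: "\<delta> > 0" for \<delta>
    proof (rule ccontr)
      assume unc: "\<not> countable ?S"
      define p where "p \<alpha> = (blinfun_apply (\<phi> \<alpha>), \<rho> \<alpha>)" for \<alpha>
      let ?K = "{g::'a \<Rightarrow> real. \<forall>y. g y \<in> {- (2 * norm y)..2 * norm y}} \<times> {b::'a \<Rightarrow> 'a \<Rightarrow> real. form 4 b}"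
      have "p \<alpha> \<in> ?K" for \<alpha>
      proof -
        have "\<bar>blinfun_apply (\<phi> \<alpha>) y\<bar> \<le> 2 * norm y" for y
        proof (rule power2_le_imp_le)
          show "\<bar>blinfun_apply (\<phi> \<alpha>) y\<bar>\<^sup>2 \<le> (2 * norm y)\<^sup>2"
            using order_trans[OF le formD(4)[OF form]] by (simp add: power_mult_distrib)
        qed simp
        then show ?thesis using form unfolding p_def by (simp add: abs_le_iff minus_le_iff)
      qed
      then have ev: "\<forall>\<^sub>F \<alpha> in cocountable ?S. p \<alpha> \<in> ?K" by (simp add: eventually_cocountable)
      obtain q where q: "\<forall>T. closed T \<longrightarrow> (\<forall>\<^sub>F \<alpha> in cocountable ?S. p \<alpha> \<in> T) \<longrightarrow> q \<in> T"
        using compact_filter_cluster[OF compact_Times[OF compact_functionals compact_form]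
            cocountable_neq_bot[OF unc] ev] by (elim bexE)
      have cl: "q \<in> T" if T: "closed T" "\<And>\<alpha>. \<alpha> \<in> ?S \<Longrightarrow> p \<alpha> \<in> T" for T
      proof -
        have "{\<alpha> \<in> ?S. p \<alpha> \<notin> T} = {}" using T(2) by blast
        then have "countable {\<alpha> \<in> ?S. p \<alpha> \<notin> T}" by (simp only: countable_empty)
        then have "\<forall>\<^sub>F \<alpha> in cocountable ?S. p \<alpha> \<in> T" by (rule eventually_cocountable[THEN iffD2])
        then show ?thesis using q T(1) by blast
      qed
      have ev1: "continuous_on UNIV (\<lambda>q::('a \<Rightarrow> real) \<times> ('a \<Rightarrow> 'a \<Rightarrow> real). fst q y)" for y
        by (rule continuous_on_product_then_coordinatewise[OF continuous_on_fst[OF continuous_on_id]])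
      have ev2: "continuous_on UNIV (\<lambda>q::('a \<Rightarrow> real) \<times> ('a \<Rightarrow> 'a \<Rightarrow> real). snd q y z)" for y z
        by (rule continuous_on_product_then_coordinatewise[OF
              continuous_on_product_then_coordinatewise[OF continuous_on_snd[OF continuous_on_id]]])
      have "q \<in> {q. \<delta> \<le> \<bar>fst q x\<bar>}"
        by (rule cl) (intro closed_Collect_le continuous_on_const continuous_on_rabs ev1, simp add: p_def)
      then have large: "\<delta> \<le> \<bar>fst q x\<bar>" by simp
      have "q \<in> {q. fst q (y - z) = fst q y - fst q z}" for y z
        by (rule cl) (intro closed_Collect_eq continuous_on_diff ev1, simp add: p_def blinfun.diff_right)
      then have diff: "fst q (y - z) = fst q y - fst q z" for y z by simp
      have "q \<in> {q. (fst q y)\<^sup>2 \<le> snd q y y}" for y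
        by (rule cl) (intro closed_Collect_le continuous_on_power ev1 ev2, simp add: p_def le)
      then have le_q: "(fst q y)\<^sup>2 \<le> snd q y y" for y by simp
      have zero_q: "fst q d = 0" if d: "d \<in> D" for d
      proof -
        have "q \<in> {q. fst q d = 0}"
          by (rule cl) (intro closed_Collect_eq continuous_on_const ev1, simp add: p_def zero[OF d])
        then show ?thesis by simp
      qed
      have agree_q: "snd q d d' = \<mu> d d'" if d: "d \<in> D" "d' \<in> D" for d d'
      proof -
        have "q \<in> {q. snd q d d' = \<mu> d d'}"
          by (rule cl) (intro closed_Collect_eq continuous_on_const ev2, simp add: p_def agree[OF d])
        then show ?thesis by simp
      qed
      have "snd q \<in> limit_forms"
      proof (rule cluster_in_limit_forms[of ?S \<rho>])
        fix T assume T: "closed T" "countable {\<beta> \<in> ?S. \<rho> \<beta> \<notin> T}"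
        have cl_T: "closed (snd -` T :: (('a \<Rightarrow> real) \<times> ('a \<Rightarrow> 'a \<Rightarrow> real)) set)"
          by (rule closed_vimage_snd[OF T(1)])
        have "\<forall>\<^sub>F \<alpha> in cocountable ?S. p \<alpha> \<in> snd -` T"
          using T(2) by (simp add: eventually_cocountable p_def)
        then have "q \<in> snd -` T" by (rule q[rule_format, OF cl_T])
        then show "snd q \<in> T" by simp
      qed (rule tail)
      from dense[OF this agree_q, of "\<delta>\<^sup>2" x] obtain d where d: "d \<in> D" "snd q (x - d) (x - d) < \<delta>\<^sup>2"
        using \<delta> by auto
      have "fst q (x - d) = fst q x" using diff[of x d] zero_q[OF d(1)] by simp
      then have "\<bar>fst q x\<bar>\<^sup>2 < \<delta>\<^sup>2" using le_less_trans[OF le_q[of "x - d"] d(2)] by simp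
      then have "\<bar>fst q x\<bar> < \<delta>" by (rule power2_less_imp_less) (use \<delta> in simp)
      then show False using large by simp
    qed
    have "{\<alpha> \<in> UNIV. blinfun_apply (\<phi> \<alpha>) x \<noteq> 0} \<subseteq> (\<Union>n. {\<alpha>. inverse (real (Suc n)) \<le> \<bar>blinfun_apply (\<phi> \<alpha>) x\<bar>})"
    proof
      fix \<alpha> assume "\<alpha> \<in> {\<alpha> \<in> UNIV. blinfun_apply (\<phi> \<alpha>) x \<noteq> 0}"
      then obtain n where "inverse (real (Suc n)) < \<bar>blinfun_apply (\<phi> \<alpha>) x\<bar>"
        using reals_Archimedean[of "\<bar>blinfun_apply (\<phi> \<alpha>) x\<bar>"] by auto
      then show "\<alpha> \<in> (\<Union>n. {\<alpha>. inverse (real (Suc n)) \<le> \<bar>blinfun_apply (\<phi> \<alpha>) x\<bar>})"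
        by (intro UN_I[of n]) simp_all
    qed
    moreover have "countable (\<Union>n. {\<alpha>. inverse (real (Suc n)) \<le> \<bar>blinfun_apply (\<phi> \<alpha>) x\<bar>})"
      by (intro countable_UN small) simp_all
    ultimately show "countable {\<alpha> \<in> UNIV. blinfun_apply (\<phi> \<alpha>) x \<noteq> 0}" by (rule countable_subset)
  qed
qed

end

lemma annihilating_family_of_uncountable_tightness:
  assumes "\<not> countably_tight (dual_ball_weak_star :: ('a::real_normed_vector \<Rightarrow>\<^sub>L real) topology)"
  shows "\<exists>\<Phi>::('a \<Rightarrow>\<^sub>L real) set. annihilates \<Phi> \<and> card_of \<Phi> \<le>o omega1_card"
proof -
  obtain A :: "('a \<Rightarrow>\<^sub>L real) set" where A: "\<And>a. a \<in> A \<Longrightarrow> norm a \<le> 2"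
    "\<And>D. countable D \<Longrightarrow> \<exists>a\<in>A. \<forall>x\<in>D. blinfun_apply a x = 0"
    "\<And>B. B \<subseteq> A \<Longrightarrow> countable B \<Longrightarrow>
      \<exists>F \<epsilon>. finite F \<and> \<epsilon> > 0 \<and> (\<forall>b\<in>B. \<epsilon> \<le> (\<Sum>x\<in>F. (blinfun_apply b x)\<^sup>2))"
    by (rule countably_closed_family[OF assms]) blast+
  from free_functionals_exist[OF A] obtain a :: "omega1 \<Rightarrow> 'a \<Rightarrow>\<^sub>L real" and F \<epsilon>
    where "free_functionals a F \<epsilon>" by blast
  then show ?thesis by (rule free_functionals.annihilating_family)
qed

theorem theorem6:
  assumes nonsep: "\<not> separable TYPE('a::banach)"
    and cases:
      "(\<exists>(I::'i set) (x::'i \<Rightarrow> 'a) (x'::'i \<Rightarrow> 'a \<Rightarrow>\<^sub>L real).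
          fundamental_biorthogonal_system I x x')
       \<or> (compact (UNIV::'k::t2_space set) \<and> scattered (UNIV::'k set) \<and>
          (\<exists>T::'a \<Rightarrow> ('k \<Rightarrow>\<^sub>C real). linear_isometry_onto T))
       \<or> (\<exists>T::omega1 ell1 \<Rightarrow> 'a. isomorphic_embedding T)
       \<or> \<not> countably_tight (dual_ball_weak_star :: ('a \<Rightarrow>\<^sub>L real) topology)"
  shows "(\<exists>\<H>::'a set set. (\<forall>H\<in>\<H>. hyperplane H) \<and> card_of \<H> =o omega1_card \<and> \<Union>\<H> = UNIV)
       \<and> cov TYPE('a) =o omega1_card"
proof -
  have "\<exists>\<Phi>::('a \<Rightarrow>\<^sub>L real) set. annihilates \<Phi> \<and> card_of \<Phi> \<le>o omega1_card"
    using cases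
  proof (elim disjE)
    assume "\<exists>(I::'i set) (x::'i \<Rightarrow> 'a) (x'::'i \<Rightarrow> 'a \<Rightarrow>\<^sub>L real).
      fundamental_biorthogonal_system I x x'"
    then show ?thesis by (elim exE) (rule fundamental_biorthogonal_annihilates[OF nonsep])
  next
    assume "compact (UNIV::'k set) \<and> scattered (UNIV::'k set) \<and>
      (\<exists>T::'a \<Rightarrow> ('k \<Rightarrow>\<^sub>C real). linear_isometry_onto T)"
    then show ?thesis by (elim conjE exE) (rule scattered_bcontfun_annihilates[OF nonsep])
  next
    assume "\<exists>T::omega1 ell1 \<Rightarrow> 'a. isomorphic_embedding T"
    then show ?thesis by (elim exE) (rule annihilating_family_of_l1_embedding[OF uncountable_omega1])
  next
    assume "\<not> countably_tight (dual_ball_weak_star :: ('a \<Rightarrow>\<^sub>L real) topology)"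
    then show ?thesis by (rule annihilating_family_of_uncountable_tightness)
  qed
  then show ?thesis by (elim exE conjE) (rule omega1_hyperplanes)
qed

end
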